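(* Let $\tau\in(2,3)$, $\mu=(\tau-1)/(\tau-2)$ and $\gamma_n=\sqrt{n\mu}$. Let $f:[0,\infty)\to[0,\infty)$ be continuous and nondecreasing with $f(x)/x\to1$ as $x\downarrow0$ and $f(x)\to1$ as $x\to\infty$. Consider the rank-1 inhomogeneous random graph on $n$ vertices with i.i.d. weights having density $\rho(h)=(\tau-1)h^{-\tau}$, $h\ge1$, and connection probability $p(h,h')=f(hh'/\gamma_n^2)$. For every fixed integer $k\ge3$, the average number $C_k(n)$ of cycles of size $k$ satisfies, as $n\to\infty$, $$C_k(n)\sim\gamma_n^{k(1-\tau)}(\tau-1)^k\,\frac1{2k}\binom nk\,k!\int_{-A}^A\cdots\int_{-A}^A F(\mathbf C\mathbf t)\,d\mathbf t,$$ where $A=\log\gamma_n$, $\mathbf t=(t_1,\dots,t_k)^T$, $$F(u_1,\dots,u_k)=j(u_1)j(u_2)\cdots j(u_k),\qquad j(u)=e^{-\frac12(\tau-1)u}f(e^u),\qquad u,u_1,\dots,u_k\in\mathbb R,$$ and $\mathbf C$ is the circulant $k\times k$ matrix with $\mathbf C_{i,i}=\mathbf C_{i,i+1}=1$ for $i=1,\dots,k$ (index $k+1$ read as $1$) and all other entries $0$, i.e. $(\mathbf C\mathbf t)_i=t_i+t_{i+1}$ with $t_{k+1}=t_1$.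
   Context: Model: the graph has $n$ vertices with i.i.d. weights $H_1,\dots,H_n$ with density $\rho$; conditionally on the weights, each pair of vertices $i\ne j$ is connected by an edge independently with probability $p(H_i,H_j)$. The average number of $k$-cycles is $$C_k(n)=\frac1{2k}\binom nk\,k!\int_1^\infty\cdots\int_1^\infty\rho(h_1)\cdots\rho(h_k)\,f\Big(\frac{h_1h_2}{\gamma_n^2}\Big)f\Big(\frac{h_2h_3}{\gamma_n^2}\Big)\cdots f\Big(\frac{h_{k-1}h_k}{\gamma_n^2}\Big)f\Big(\frac{h_kh_1}{\gamma_n^2}\Big)\,dh_1\cdots dh_k .$$ Notation: $g_1(n)\sim g_2(n)$ means $g_1(n)/g_2(n)\to1$ as $n\to\infty$. *)

theory Defs
  imports "HOL-Probability.Probability" "HOL-Probability.Product_PMF"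
begin

(* The weight law lives on [1,\<infinity>) itself rather than on the whole line, so that f, which is only
   constrained on [0,\<infinity>), is never evaluated at a negative argument in the random graph. *)
definition weight_law :: "real \<Rightarrow> real measure" where
  "weight_law \<tau> = density (restrict_space lborel {1..}) (\<lambda>h. ennreal ((\<tau> - 1) * h powr (- \<tau>)))"

(* Simple graphs on the vertex set {..<n} are represented by their edge sets. *)
definition all_edges :: "nat \<Rightarrow> nat set set" where
  "all_edges n = {e. e \<subseteq> {..<n} \<and> card e = 2}"

(* Conditional law of the graph given the weights h. The edge {i,j} with i < j has probability
   p (h i) (h j); p is meant to be symmetric and [0,1]-valued. *)
definition graph_given_weights ::
    "nat \<Rightarrow> (real \<Rightarrow> real \<Rightarrow> real) \<Rightarrow> (nat \<Rightarrow> real) \<Rightarrow> nat set set pmf" where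
  "graph_given_weights n p h =
     map_pmf (\<lambda>x. {e. x e})
       (Pi_pmf (all_edges n) False (\<lambda>e. bernoulli_pmf (p (h (Min e)) (h (Max e)))))"

definition inhom_random_graph ::
    "nat \<Rightarrow> real measure \<Rightarrow> (real \<Rightarrow> real \<Rightarrow> real) \<Rightarrow> nat set set measure" where
  "inhom_random_graph n W p =
     bind (Pi\<^sub>M {..<n} (\<lambda>_. W)) (\<lambda>h. measure_pmf (graph_given_weights n p h))"

(* Cycles are counted as subgraphs: a k-cycle is the edge set of a closed walk through k distinct
   vertices, so the 2k choices of starting point and orientation give the same cycle (k \<ge> 3). *)
definition cycles :: "nat \<Rightarrow> nat set set \<Rightarrow> nat set set set" where
  "cycles k E = {(\<lambda>i. {v i, v (Suc i mod k)}) ` {..<k} | v.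
     inj_on v {..<k} \<and> (\<forall>i<k. {v i, v (Suc i mod k)} \<in> E)}"

definition \<mu>_of :: "real \<Rightarrow> real" where
  "\<mu>_of \<tau> = (\<tau> - 1) / (\<tau> - 2)"

definition \<gamma> :: "real \<Rightarrow> nat \<Rightarrow> real" where
  "\<gamma> \<tau> n = sqrt (real n * \<mu>_of \<tau>)"

definition avg_cycles :: "real \<Rightarrow> (real \<Rightarrow> real) \<Rightarrow> nat \<Rightarrow> nat \<Rightarrow> real" where
  "avg_cycles \<tau> f k n =
     (\<integral>E. real (card (cycles k E))
        \<partial>inhom_random_graph n (weight_law \<tau>) (\<lambda>h h'. f (h * h' / (\<gamma> \<tau> n)\<^sup>2)))"

definition j_fun :: "real \<Rightarrow> (real \<Rightarrow> real) \<Rightarrow> real \<Rightarrow> real" where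
  "j_fun \<tau> f u = exp (- (1 / 2) * (\<tau> - 1) * u) * f (exp u)"

(* Vectors in R^k are functions nat \<Rightarrow> real considered on the indices {..<k}, i.e. the coordinates
   1,...,k are shifted to 0,...,k-1. *)
definition F_fun :: "real \<Rightarrow> (real \<Rightarrow> real) \<Rightarrow> nat \<Rightarrow> (nat \<Rightarrow> real) \<Rightarrow> real" where
  "F_fun \<tau> f k u = (\<Prod>i<k. j_fun \<tau> f (u i))"

definition circ :: "nat \<Rightarrow> nat \<Rightarrow> nat \<Rightarrow> real" where
  "circ k i l = (if l = i \<or> l = Suc i mod k then 1 else 0)"

definition mat_vec :: "nat \<Rightarrow> (nat \<Rightarrow> nat \<Rightarrow> real) \<Rightarrow> (nat \<Rightarrow> real) \<Rightarrow> nat \<Rightarrow> real" where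
  "mat_vec k M t i = (\<Sum>l<k. M i l * t l)"

definition cube_integral :: "nat \<Rightarrow> real \<Rightarrow> ((nat \<Rightarrow> real) \<Rightarrow> real) \<Rightarrow> real" where
  "cube_integral k A g =
     (LINT t : (\<Pi>\<^sub>E i\<in>{..<k}. {-A..A}) | Pi\<^sub>M {..<k} (\<lambda>_. lborel). g t)"

end

theory Submission
  imports Defs
begin

text \<open>The expected number of cycles is the number of cycles of the complete graph times the
  probability that a given one is present. Substituting \<open>h\<^sub>i = \<gamma>\<^sub>n exp t\<^sub>i\<close>, and sharing
  the weight \<open>exp (- (\<tau> - 1) t\<^sub>i)\<close> equally between the two edges at \<open>i\<close>, turns this probability
  into the integral of \<open>F (C t)\<close> over the orthant \<open>t\<^sub>i \<ge> - A\<close>, so it remains to compare the orthant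
  with the cube. The part of the orthant outside the cube contributes at most a constant
  independent of \<open>n\<close>, and also at most the integral over the complement of the cube. If \<open>F (C t)\<close>
  is not integrable over the whole space (even \<open>k\<close>, where \<open>C\<close> is singular), the integral over the
  cube diverges and the first bound suffices; if it is integrable (odd \<open>k\<close>), the second bound
  tends to 0. The parity of \<open>k\<close> itself is never used.\<close>

section \<open>Integrals of cyclic products over orthants and cubes\<close>

text \<open>The weight \<open>exp (- (\<tau> - 1) t\<^sub>i)\<close> combines the density
  \<open>h powr (- \<tau>)\<close> with the Jacobian \<open>h\<close>. Every vertex lies on exactly
  two edges, so halving its exponent leaves an integrand each of whose factors depends on a single
  sum of neighbouring coordinates. This translation structure lets the integral over a path split
  into powers of the one-dimensional integral of \<open>j\<close>. It is also the obstacle: for even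
  \<open>k\<close> a shift with alternating signs leaves \<open>F (C t)\<close> unchanged, so the
  cube integral has no finite limit, and the error has to be bounded uniformly in the size of the
  cube. Finiteness of the orthant integral for each large \<open>n\<close> is not estimated at all:
  it is read off from being a positive multiple of a probability. The comparison takes place in
  \<open>ennreal\<close>, where the two regimes differ only in the value of one possibly infinite
  limit.\<close>

lemma nn_integral_path:
  fixes g w :: "real \<Rightarrow> ennreal" and \<sigma> :: "nat \<Rightarrow> nat"
  assumes g[measurable]: "g \<in> borel_measurable borel"
    and w[measurable]: "w \<in> borel_measurable borel"
    and "inj_on \<sigma> {..m}"
  shows "(\<integral>\<^sup>+t. (\<Prod>l<m. g (t (\<sigma> l) + t (\<sigma> (Suc l)))) * w (t (\<sigma> m))
            \<partial>Pi\<^sub>M (\<sigma> ` {..m}) (\<lambda>_. lborel))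
         = (\<integral>\<^sup>+u. g u \<partial>lborel) ^ m * (\<integral>\<^sup>+u. w u \<partial>lborel)"
  using assms(3)
\<comment> \<open>The path is peeled at its free end \<open>\<sigma> 0\<close>, whose coordinate
  occurs in one factor only. What remains is a path labelled by
  \<open>\<lambda>l. \<sigma> (Suc l)\<close>, hence the generalisation over
  \<open>\<sigma>\<close>.\<close>
proof (induction m arbitrary: \<sigma>)
  case 0
  interpret product_sigma_finite "\<lambda>_::nat. lborel :: real measure" ..
  show ?case
    using product_nn_integral_singleton[of w "\<sigma> 0"] by simp
next
  case (Suc m)
  interpret product_sigma_finite "\<lambda>_::nat. lborel :: real measure" ..
  let ?I = "(\<lambda>l. \<sigma> (Suc l)) ` {..m}"
  let ?h = "\<lambda>t::nat \<Rightarrow> real. (\<Prod>l<m. g (t (\<sigma> (Suc l)) + t (\<sigma> (Suc (Suc l))))) * w (t (\<sigma> (Suc m)))"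
  have inj: "inj_on (\<lambda>l. \<sigma> (Suc l)) {..m}"
    using Suc.prems by (auto simp: inj_on_def)
  have notin: "\<sigma> 0 \<notin> ?I"
    using Suc.prems by (auto simp: inj_on_def)
  have img: "\<sigma> ` {..Suc m} = insert (\<sigma> 0) ?I"
    by (auto simp: atMost_Suc_eq_insert_0)
  have meas[measurable]: "(\<lambda>t. g (t (\<sigma> 0) + t (\<sigma> (Suc 0))) * ?h t)
      \<in> borel_measurable (Pi\<^sub>M (insert (\<sigma> 0) ?I) (\<lambda>_. lborel))"
    by measurable
  have "(\<integral>\<^sup>+t. (\<Prod>l<Suc m. g (t (\<sigma> l) + t (\<sigma> (Suc l)))) * w (t (\<sigma> (Suc m)))
            \<partial>Pi\<^sub>M (\<sigma> ` {..Suc m}) (\<lambda>_. lborel))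
      = (\<integral>\<^sup>+t. g (t (\<sigma> 0) + t (\<sigma> (Suc 0))) * ?h t \<partial>Pi\<^sub>M (insert (\<sigma> 0) ?I) (\<lambda>_. lborel))"
    unfolding img by (simp add: prod.lessThan_Suc_shift mult.assoc del: prod.lessThan_Suc)
  also have "\<dots> = (\<integral>\<^sup>+t. (\<integral>\<^sup>+y. g (y + t (\<sigma> (Suc 0))) * ?h t \<partial>lborel) \<partial>Pi\<^sub>M ?I (\<lambda>_. lborel))"
  proof (subst product_nn_integral_insert[OF _ notin meas], simp, intro nn_integral_cong)
    fix t :: "nat \<Rightarrow> real" and y :: real
    have "\<sigma> (Suc l) \<noteq> \<sigma> 0" if "l \<le> m" for l
      using notin that by (metis atMost_iff image_eqI)
    then show "g ((t(\<sigma> 0 := y)) (\<sigma> 0) + (t(\<sigma> 0 := y)) (\<sigma> (Suc 0))) * ?h (t(\<sigma> 0 := y))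
        = g (y + t (\<sigma> (Suc 0))) * ?h t"
      by (auto intro!: arg_cong2[where f = "(*)"] prod.cong)
  qed
  \<comment> \<open>By translation invariance of \<open>lborel\<close> the inner integral does not
    depend on the coordinate of the neighbour.\<close>
  also have "\<dots> = (\<integral>\<^sup>+t. (\<integral>\<^sup>+u. g u \<partial>lborel) * ?h t \<partial>Pi\<^sub>M ?I (\<lambda>_. lborel))"
  proof (intro nn_integral_cong)
    fix t :: "nat \<Rightarrow> real"
    have "(\<integral>\<^sup>+u. g u \<partial>lborel) = (\<integral>\<^sup>+y. g (y + t (\<sigma> (Suc 0))) \<partial>lborel)"
      using nn_integral_real_affine[of g 1 "t (\<sigma> (Suc 0))"] by (simp add: add.commute)
    then show "(\<integral>\<^sup>+y. g (y + t (\<sigma> (Suc 0))) * ?h t \<partial>lborel) = (\<integral>\<^sup>+u. g u \<partial>lborel) * ?h t"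
      by (subst nn_integral_multc) auto
  qed
  also have "\<dots> = (\<integral>\<^sup>+u. g u \<partial>lborel) * (\<integral>\<^sup>+t. ?h t \<partial>Pi\<^sub>M ?I (\<lambda>_. lborel))"
    by (rule nn_integral_cmult) measurable
  also have "(\<integral>\<^sup>+t. ?h t \<partial>Pi\<^sub>M ?I (\<lambda>_. lborel)) = (\<integral>\<^sup>+u. g u \<partial>lborel) ^ m * (\<integral>\<^sup>+u. w u \<partial>lborel)"
    using Suc.IH[OF inj] .
  finally show ?case by (simp add: mult.assoc)
qed

lemma nn_integral_exp_atLeast:
  fixes c a :: real
  assumes "0 < c"
  shows "(\<integral>\<^sup>+u. ennreal (exp (- c * (u - a))) * indicator {a..} u \<partial>lborel) = ennreal (1 / c)"
proof -
  have "filterlim (\<lambda>u. c * (- a + u)) at_top at_top"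
    using assms
    by (intro filterlim_tendsto_pos_mult_at_top[OF tendsto_const]
        filterlim_tendsto_add_at_top[OF tendsto_const] filterlim_ident)
  then have "((\<lambda>u. exp (- (c * (- a + u)))) \<longlongrightarrow> 0) at_top"
    by (intro filterlim_compose[OF exp_at_bot] filterlim_compose[OF filterlim_uminus_at_bot_at_top])
  then have lim: "((\<lambda>u. - exp (- c * (u - a)) / c) \<longlongrightarrow> 0) at_top"
    using tendsto_divide_zero[of "\<lambda>u. - exp (- (c * (- a + u)))" at_top c]
    by (simp add: tendsto_minus_cancel_left[symmetric] algebra_simps)
  have "(\<integral>\<^sup>+u. ennreal (exp (- c * (u - a))) * indicator {a..} u \<partial>lborel)
      = ennreal (0 - (- exp (- c * (a - a)) / c))"
    using assms lim
    by (intro nn_integral_FTC_atLeast) (auto intro!: derivative_eq_intros simp: field_simps)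
  then show ?thesis by simp
qed

text \<open>Rotation of the cyclic index set: distinct indices below \<open>k\<close> differ by less
  than \<open>k\<close>. It allows the cycle to be cut at any vertex and cyclic sums to be
  shifted.\<close>

lemma bij_betw_mod_shift:
  fixes a k :: nat
  assumes "0 < k"
  shows "bij_betw (\<lambda>l. (a + l) mod k) {..<k} {..<k}"
proof -
  have "inj_on (\<lambda>l. (a + l) mod k) {..<k}"
  proof (rule linorder_inj_onI')
    fix x y assume *: "x \<in> {..<k}" "y \<in> {..<k}" "x < y"
    then have "\<not> k dvd (a + y) - (a + x)"
      by (auto dest: dvd_imp_le)
    with * show "(a + x) mod k \<noteq> (a + y) mod k"
      using mod_eq_dvd_iff_nat[of "a + x" "a + y" k] by simp
  qed
  moreover have "(\<lambda>l. (a + l) mod k) ` {..<k} \<subseteq> {..<k}"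
    using assms by auto
  ultimately show ?thesis
    by (simp add: bij_betw_def endo_inj_surj)
qed

text \<open>With \<open>j\<close> for \<open>g\<close> this is \<open>F (C t)\<close>, valued in
  \<open>ennreal\<close> so that its integral exists whether or not it is finite.\<close>

definition cyc_prod :: "(real \<Rightarrow> ennreal) \<Rightarrow> nat \<Rightarrow> (nat \<Rightarrow> real) \<Rightarrow> ennreal" where
  "cyc_prod g k t = (\<Prod>i<k. g (t i + t (Suc i mod k)))"

lemma measurable_cyc_prod[measurable]:
  assumes [measurable]: "g \<in> borel_measurable borel"
  shows "cyc_prod g k \<in> borel_measurable (Pi\<^sub>M {..<k} (\<lambda>_. lborel))"
  unfolding cyc_prod_def by measurable

text \<open>Cutting the cycle at the edge \<open>{i, i + 1}\<close> leaves a path ending in \<open>i\<close>; since both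
  \<open>t (i + 1) \<ge> - A\<close> and \<open>t i > A\<close>, the factor of the removed edge decays exponentially in
  \<open>t i - A\<close>.\<close>
lemma cyc_prod_tail_le:
  fixes g :: "real \<Rightarrow> ennreal"
  assumes [measurable]: "g \<in> borel_measurable borel"
    and "0 < c" and le: "\<And>u. g u \<le> ennreal (exp (- c * u))"
    and "i < k"
  shows "(\<integral>\<^sup>+t. cyc_prod g k t * indicator {t. A < t i \<and> - A \<le> t (Suc i mod k)} t
            \<partial>Pi\<^sub>M {..<k} (\<lambda>_. lborel))
         \<le> (\<integral>\<^sup>+u. g u \<partial>lborel) ^ (k - 1) * ennreal (1 / c)"
proof -
  \<comment> \<open>\<open>\<sigma>\<close> walks round the cycle from the successor of
    \<open>i\<close> and reaches \<open>i\<close> after \<open>k - 1\<close> steps, so its steps use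
    every edge except the removed one.\<close>
  define \<sigma> where "\<sigma> l = (Suc i + l) mod k" for l
  define w where "w u = ennreal (exp (- c * (u - A))) * indicator {A..} u" for u
  have k: "0 < k" using \<open>i < k\<close> by simp
  have bij: "bij_betw \<sigma> {..<k} {..<k}"
    unfolding \<sigma>_def using bij_betw_mod_shift[OF k] .
  have atMost: "{..k - 1} = {..<k}" using k by auto
  have img: "\<sigma> ` {..k - 1} = {..<k}" and inj: "inj_on \<sigma> {..k - 1}"
    using bij unfolding atMost bij_betw_def by blast+
  have \<sigma>_Suc: "Suc (\<sigma> l) mod k = \<sigma> (Suc l)" for l
    by (simp add: \<sigma>_def mod_Suc_eq)
  have \<sigma>_last: "\<sigma> (k - 1) = i"
    using \<open>i < k\<close> by (simp add: \<sigma>_def)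
  have [measurable]: "w \<in> borel_measurable borel" unfolding w_def by measurable
  have split: "cyc_prod g k t = (\<Prod>l<k - 1. g (t (\<sigma> l) + t (\<sigma> (Suc l)))) * g (t i + t (Suc i mod k))" for t
  proof -
    have "cyc_prod g k t = (\<Prod>l<k. g (t (\<sigma> l) + t (\<sigma> (Suc l))))"
      unfolding cyc_prod_def
      by (subst prod.reindex_bij_betw[OF bij, symmetric]) (simp add: \<sigma>_Suc)
    also have "\<dots> = (\<Prod>l<Suc (k - 1). g (t (\<sigma> l) + t (\<sigma> (Suc l))))"
      using k by simp
    also have "\<dots> = (\<Prod>l<k - 1. g (t (\<sigma> l) + t (\<sigma> (Suc l)))) * g (t i + t (Suc i mod k))"
      unfolding prod.lessThan_Suc using \<sigma>_last \<sigma>_Suc by metis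
    finally show ?thesis .
  qed
  have "(\<integral>\<^sup>+t. cyc_prod g k t * indicator {t. A < t i \<and> - A \<le> t (Suc i mod k)} t
            \<partial>Pi\<^sub>M {..<k} (\<lambda>_. lborel))
      \<le> (\<integral>\<^sup>+t. (\<Prod>l<k - 1. g (t (\<sigma> l) + t (\<sigma> (Suc l)))) * w (t (\<sigma> (k - 1)))
            \<partial>Pi\<^sub>M (\<sigma> ` {..k - 1}) (\<lambda>_. lborel))"
    unfolding img split
  proof (intro nn_integral_mono)
    fix t :: "nat \<Rightarrow> real"
    have "g (t i + t (Suc i mod k)) \<le> w (t i)" if "A < t i" "- A \<le> t (Suc i mod k)"
    proof -
      have "c * (t i - A) \<le> c * (t i + t (Suc i mod k))"
        using that \<open>0 < c\<close> by (intro mult_left_mono) auto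
      then have "ennreal (exp (- c * (t i + t (Suc i mod k)))) \<le> w (t i)"
        using that by (auto simp: w_def intro!: ennreal_leI)
      then show ?thesis using le order_trans by blast
    qed
    then show "(\<Prod>l<k - 1. g (t (\<sigma> l) + t (\<sigma> (Suc l)))) * g (t i + t (Suc i mod k)) *
            indicator {t. A < t i \<and> - A \<le> t (Suc i mod k)} t
        \<le> (\<Prod>l<k - 1. g (t (\<sigma> l) + t (\<sigma> (Suc l)))) * w (t (\<sigma> (k - 1)))"
      by (auto simp: \<sigma>_last[simplified] indicator_def intro!: mult_left_mono)
  qed
  also have "\<dots> = (\<integral>\<^sup>+u. g u \<partial>lborel) ^ (k - 1) * (\<integral>\<^sup>+u. w u \<partial>lborel)"
    by (rule nn_integral_path) (use inj in auto)
  also have "(\<integral>\<^sup>+u. w u \<partial>lborel) = ennreal (1 / c)"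
    unfolding w_def using nn_integral_exp_atLeast[OF \<open>0 < c\<close>] .
  finally show ?thesis .
qed

section \<open>Cubes, orthants and the part of an orthant outside the cube\<close>

abbreviation cube :: "nat \<Rightarrow> real \<Rightarrow> (nat \<Rightarrow> real) set" where
  "cube k A \<equiv> (\<Pi>\<^sub>E i\<in>{..<k}. {-A..A})"

abbreviation orthant :: "nat \<Rightarrow> real \<Rightarrow> (nat \<Rightarrow> real) set" where
  "orthant k A \<equiv> (\<Pi>\<^sub>E i\<in>{..<k}. {-A..})"

text \<open>Union bound over the coordinate that exceeds \<open>A\<close>; of the orthant
  constraints only the one on its successor is kept, since that is all the tail bound uses. The
  right-hand side is free of \<open>A\<close>.\<close>

lemma nn_integral_orthant_minus_cube_le:
  fixes g :: "real \<Rightarrow> ennreal"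
  assumes [measurable]: "g \<in> borel_measurable borel"
    and c: "0 < c" "\<And>u. g u \<le> ennreal (exp (- c * u))"
  shows "(\<integral>\<^sup>+t. cyc_prod g k t * indicator (orthant k A - cube k A) t \<partial>Pi\<^sub>M {..<k} (\<lambda>_. lborel))
         \<le> of_nat k * ((\<integral>\<^sup>+u. g u \<partial>lborel) ^ (k - 1) * ennreal (1 / c))"
proof -
  let ?T = "\<lambda>i. {t::nat \<Rightarrow> real. A < t i \<and> - A \<le> t (Suc i mod k)}"
  have [measurable]: "(\<lambda>t. indicator (?T i) t :: ennreal)
      \<in> borel_measurable (Pi\<^sub>M {..<k} (\<lambda>_. lborel))" if "i < k" for i
  proof -
    have [measurable]: "(\<lambda>t. t (Suc i mod k)) \<in> borel_measurable (Pi\<^sub>M {..<k} (\<lambda>_. lborel :: real measure))"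
      "(\<lambda>t. t i) \<in> borel_measurable (Pi\<^sub>M {..<k} (\<lambda>_. lborel :: real measure))"
      using that by (auto intro!: measurable_component_singleton measurable_lborel2 mod_less_divisor)
    show ?thesis unfolding indicator_def by measurable
  qed
  have "(\<integral>\<^sup>+t. cyc_prod g k t * indicator (orthant k A - cube k A) t \<partial>Pi\<^sub>M {..<k} (\<lambda>_. lborel))
      \<le> (\<integral>\<^sup>+t. (\<Sum>i<k. cyc_prod g k t * indicator (?T i) t) \<partial>Pi\<^sub>M {..<k} (\<lambda>_. lborel))"
  proof (intro nn_integral_mono)
    fix t :: "nat \<Rightarrow> real"
    show "cyc_prod g k t * indicator (orthant k A - cube k A) t \<le> (\<Sum>i<k. cyc_prod g k t * indicator (?T i) t)"
    proof (cases "t \<in> orthant k A - cube k A")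
      case True
      then obtain i where i: "i < k" "A < t i"
        by (force simp: PiE_iff not_le)
      then have "Suc i mod k < k" by simp
      with True have "- A \<le> t (Suc i mod k)" by (auto simp: PiE_iff)
      with i have "cyc_prod g k t = cyc_prod g k t * indicator (?T i) t" by simp
      also have "\<dots> \<le> (\<Sum>i<k. cyc_prod g k t * indicator (?T i) t)"
        using i by (intro member_le_sum) auto
      finally show ?thesis using True by simp
    qed simp
  qed
  also have "\<dots> = (\<Sum>i<k. \<integral>\<^sup>+t. cyc_prod g k t * indicator (?T i) t \<partial>Pi\<^sub>M {..<k} (\<lambda>_. lborel))"
    by (intro nn_integral_sum) auto
  also have "\<dots> \<le> (\<Sum>i<k. (\<integral>\<^sup>+u. g u \<partial>lborel) ^ (k - 1) * ennreal (1 / c))"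
    using c by (intro sum_mono cyc_prod_tail_le) auto
  finally show ?thesis by simp
qed

text \<open>Monotone convergence along exhausting cubes; the limit may be infinite.\<close>

lemma tendsto_cube_nn_integral:
  fixes \<Phi> :: "(nat \<Rightarrow> real) \<Rightarrow> ennreal"
  assumes [measurable]: "\<Phi> \<in> borel_measurable (Pi\<^sub>M {..<k} (\<lambda>_. lborel))"
    and A: "incseq A" "filterlim A at_top sequentially"
  shows "(\<lambda>n. \<integral>\<^sup>+t. \<Phi> t * indicator (cube k (A n)) t \<partial>Pi\<^sub>M {..<k} (\<lambda>_. lborel))
         \<longlonglongrightarrow> (\<integral>\<^sup>+t. \<Phi> t \<partial>Pi\<^sub>M {..<k} (\<lambda>_. lborel))"
proof -
  \<comment> \<open>A non-extensional \<open>t\<close> lies in no cube, so the pointwise limit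
    carries the indicator of the extensional functions; these form the whole space of the product
    measure, and the indicator disappears at the end.\<close>
  have "(\<lambda>n. \<integral>\<^sup>+t. \<Phi> t * indicator (cube k (A n)) t \<partial>Pi\<^sub>M {..<k} (\<lambda>_. lborel))
      \<longlonglongrightarrow> (\<integral>\<^sup>+t. \<Phi> t * indicator (PiE {..<k} (\<lambda>_. UNIV)) t \<partial>Pi\<^sub>M {..<k} (\<lambda>_. lborel))"
  proof (rule nn_integral_LIMSEQ)
    have "cube k (A m) \<subseteq> cube k (A n)" if "m \<le> n" for m n
      using incseqD[OF A(1) that] by (intro PiE_mono) auto
    then have "(indicator (cube k (A m)) t :: ennreal) \<le> indicator (cube k (A n)) t" if "m \<le> n" for m n t
      using that by (meson indicator_leI subsetD)
    then show "incseq (\<lambda>n t. \<Phi> t * indicator (cube k (A n)) t)"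
      by (intro monoI le_funI mult_left_mono) auto
    show "(\<lambda>t. \<Phi> t * indicator (cube k (A n)) t) \<in> borel_measurable (Pi\<^sub>M {..<k} (\<lambda>_. lborel))" for n
      by measurable
    fix t :: "nat \<Rightarrow> real"
    have "\<forall>\<^sub>F n in sequentially. (indicator (cube k (A n)) t :: ennreal) = indicator (PiE {..<k} (\<lambda>_. UNIV)) t"
    proof (cases "t \<in> PiE {..<k} (\<lambda>_. UNIV)")
      case True
      \<comment> \<open>The sum is one threshold that dominates all coordinates at once.\<close>
      have "\<forall>\<^sub>F n in sequentially. (\<Sum>i<k. \<bar>t i\<bar>) \<le> A n"
        using A(2) by (simp add: filterlim_at_top)
      then show ?thesis
      proof eventually_elim
        case (elim n)
        have "\<bar>t i\<bar> \<le> A n" if "i < k" for i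
          using member_le_sum[of i "{..<k}" "\<lambda>i. \<bar>t i\<bar>"] that elim by auto
        then have "t i \<in> {- A n..A n}" if "i < k" for i
          using that by (simp add: abs_le_iff) (metis minus_le_iff)
        then have "t \<in> cube k (A n)" using True by (auto simp: PiE_iff)
        then show ?case using True by simp
      qed
    next
      case False
      then have "t \<notin> cube k (A n)" for n by (auto simp: PiE_iff)
      with False show ?thesis by simp
    qed
    then show "(\<lambda>n. \<Phi> t * indicator (cube k (A n)) t) \<longlonglongrightarrow> \<Phi> t * indicator (PiE {..<k} (\<lambda>_. UNIV)) t"
      by (intro tendsto_eventually) (auto elim!: eventually_mono)
  qed
  also have "(\<integral>\<^sup>+t. \<Phi> t * indicator (PiE {..<k} (\<lambda>_. UNIV)) t \<partial>Pi\<^sub>M {..<k} (\<lambda>_. lborel))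
      = (\<integral>\<^sup>+t. \<Phi> t \<partial>Pi\<^sub>M {..<k} (\<lambda>_. lborel))"
    by (intro nn_integral_cong) (auto simp: space_PiM)
  finally show ?thesis .
qed

text \<open>The space contains the unit cube. This turns strict positivity of an integrand into
  strict positivity of its integral.\<close>

lemma emeasure_Pi_lborel_space_pos:
  "0 < emeasure (Pi\<^sub>M {..<k::nat} (\<lambda>_. lborel :: real measure)) (\<Pi>\<^sub>E i\<in>{..<k}. UNIV)"
proof -
  interpret product_sigma_finite "\<lambda>_::nat. lborel :: real measure" ..
  have "0 < (\<Prod>i<k. emeasure lborel {0..1::real})"
    by simp
  also have "\<dots> = emeasure (Pi\<^sub>M {..<k} (\<lambda>_. lborel :: real measure)) (\<Pi>\<^sub>E i\<in>{..<k}. {0..1})"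
    by (rule emeasure_PiM[symmetric]) auto
  also have "\<dots> \<le> emeasure (Pi\<^sub>M {..<k} (\<lambda>_. lborel :: real measure)) (\<Pi>\<^sub>E i\<in>{..<k}. UNIV)"
    by (intro emeasure_mono PiE_mono sets_PiM_I_finite) auto
  finally show ?thesis .
qed

text \<open>\<open>J\<close>, \<open>M\<close> and \<open>T\<close> stand for the integrals over the
  orthant, the cube and their difference, and \<open>S\<close> for the integral over the whole
  space. For infinite \<open>S\<close> the bound \<open>K\<close> on \<open>T\<close> is negligible
  against \<open>M\<close>; for finite \<open>S\<close> the remainder is squeezed by
  \<open>S - M\<close>. The condition \<open>fin\<close> is essential for passing to reals, because
  \<open>enn2real \<top> = 0\<close>.\<close>

lemma ratio_tendsto_1_of_bounded_tail:
  fixes J M T :: "nat \<Rightarrow> ennreal" and S K :: ennreal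
  assumes J: "\<And>n. J n = M n + T n"
    and fin: "\<forall>\<^sub>F n in sequentially. J n < \<top>"
    and M: "M \<longlonglongrightarrow> S" and "0 < S"
    and K: "\<And>n. T n \<le> K" "K < \<top>"
    and S: "\<And>n. M n + T n \<le> S"
  shows "(\<lambda>n. enn2real (J n) / enn2real (M n)) \<longlonglongrightarrow> 1"
proof -
  define m t where "m n = enn2real (M n)" and "t n = enn2real (T n)" for n
  have ev: "\<forall>\<^sub>F n in sequentially. M n = ennreal (m n) \<and> T n = ennreal (t n) \<and> 0 < m n"
    using fin order_tendstoD(1)[OF M \<open>0 < S\<close>]
  proof eventually_elim
    case (elim n)
    then have "M n < \<top>" "T n < \<top>" by (auto simp: J)
    with elim show ?case by (auto simp: m_def t_def enn2real_positive_iff)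
  qed
  have M_eq: "\<forall>\<^sub>F n in sequentially. M n = ennreal (m n)"
    using ev by eventually_elim simp
  have t0: "0 \<le> t n" for n by (simp add: t_def)
  have "(\<lambda>n. t n / m n) \<longlonglongrightarrow> 0"
  proof (cases "S = \<top>")
    case True
    have "(\<lambda>n. ennreal (m n)) \<longlonglongrightarrow> \<top>"
      using Lim_transform_eventually[OF M M_eq] True by simp
    then have "filterlim m at_top sequentially"
      by (simp add: ennreal_tendsto_top_eq_at_top)
    then have "(\<lambda>n. enn2real K / m n) \<longlonglongrightarrow> 0"
      by (intro tendsto_divide_0[OF tendsto_const] filterlim_at_top_imp_at_infinity)
    moreover have "\<forall>\<^sub>F n in sequentially. t n / m n \<le> enn2real K / m n"
      using ev
    proof eventually_elim
      case (elim n)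
      have "t n \<le> enn2real K" using K by (auto simp: t_def intro: enn2real_mono)
      with elim show ?case by (simp add: divide_right_mono)
    qed
    moreover have "\<forall>\<^sub>F n in sequentially. 0 \<le> t n / m n"
      using ev by eventually_elim (simp add: t0)
    ultimately show ?thesis
      using tendsto_sandwich[of "\<lambda>_. 0" "\<lambda>n. t n / m n" sequentially "\<lambda>n. enn2real K / m n" 0]
      by simp
  next
    case False
    define s where "s = enn2real S"
    have s: "S = ennreal s" "0 < s"
      using False \<open>0 < S\<close> by (auto simp: s_def less_top enn2real_positive_iff)
    have "(\<lambda>n. ennreal (m n)) \<longlonglongrightarrow> ennreal s"
      using Lim_transform_eventually[OF M M_eq] s by simp
    then have ms: "m \<longlonglongrightarrow> s"
      using s by (subst (asm) tendsto_ennreal_iff) (auto simp: m_def)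
    have "(\<lambda>n. s - m n) \<longlonglongrightarrow> 0"
      using tendsto_diff[OF tendsto_const[of s] ms] by simp
    moreover have "\<forall>\<^sub>F n in sequentially. t n \<le> s - m n"
      using ev
    proof eventually_elim
      case (elim n)
      have "ennreal (m n + t n) \<le> ennreal s"
        using S[of n] elim t0[of n] by (simp add: s ennreal_plus)
      then show ?case using s by (simp add: ennreal_le_iff)
    qed
    moreover have "\<forall>\<^sub>F n in sequentially. 0 \<le> t n"
      using t0 by simp
    ultimately have "t \<longlonglongrightarrow> 0"
      using tendsto_sandwich[of "\<lambda>_. 0" t sequentially "\<lambda>n. s - m n" 0] by simp
    then show ?thesis
      using tendsto_divide[OF _ ms, of t 0] s by simp
  qed
  then have "(\<lambda>n. 1 + t n / m n) \<longlonglongrightarrow> 1"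
    using tendsto_add[OF tendsto_const[of 1], of "\<lambda>n. t n / m n" 0] by simp
  moreover have "\<forall>\<^sub>F n in sequentially. 1 + t n / m n = enn2real (J n) / enn2real (M n)"
    using ev
  proof eventually_elim
    case (elim n)
    then have "enn2real (J n) = m n + t n"
      using t0[of n] by (simp add: J ennreal_plus[symmetric] del: ennreal_plus)
    moreover have "enn2real (M n) = m n" by (simp add: m_def)
    ultimately show ?case using elim by (simp add: field_simps)
  qed
  ultimately show ?thesis
    by (rule Lim_transform_eventually)
qed

text \<open>The two unit entries of a row lie in different columns only when
  \<open>2 \<le> k\<close>; for \<open>k = 1\<close> they would merge and give \<open>t i\<close>
  instead of its double.\<close>

lemma mat_vec_circ:
  assumes "2 \<le> k" "i < k"
  shows "mat_vec k (circ k) t i = t i + t (Suc i mod k)"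
proof -
  have ne: "Suc i mod k \<noteq> i"
    using assms by (cases "Suc i = k") auto
  have "mat_vec k (circ k) t i = (\<Sum>l<k. (if l = i then t l else 0) + (if l = Suc i mod k then t l else 0))"
    unfolding mat_vec_def circ_def using ne by (intro sum.cong) auto
  also have "\<dots> = t i + t (Suc i mod k)"
    using assms by (simp add: sum.distrib)
  finally show ?thesis .
qed

section \<open>Bounds on the connection function, integrability of \<open>j\<close>, and the
  comparison of orthant and cube\<close>

locale connection_kernel =
  fixes \<tau> :: real and f :: "real \<Rightarrow> real"
  assumes tau: "2 < \<tau>" "\<tau> < 3"
    and f_nonneg: "\<And>x. 0 \<le> x \<Longrightarrow> 0 \<le> f x"
    and f_cont: "continuous_on {0..} f"
    and f_mono: "mono_on {0..} f"
    and f_at_0: "((\<lambda>x. f x / x) \<longlongrightarrow> 1) (at_right 0)"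
    and f_at_top: "(f \<longlongrightarrow> 1) at_top"
begin

text \<open>A nondecreasing function stays below its limit at infinity.\<close>

lemma f_le_1: "f x \<le> 1" if "0 \<le> x"
proof (rule tendsto_lowerbound[OF f_at_top])
  show "\<forall>\<^sub>F y in at_top. f x \<le> f y"
    using eventually_ge_at_top[of x]
    by eventually_elim (use that in \<open>auto intro!: mono_onD[OF f_mono]\<close>)
qed simp

text \<open>Since \<open>f y / y\<close> tends to 1, \<open>f\<close> is positive at some point
  below \<open>x\<close>, and monotonicity carries this up to \<open>x\<close>.\<close>

lemma f_pos: "0 < f x" if "0 < x"
proof -
  have "\<forall>\<^sub>F y in at_right 0. 0 < f y / y \<and> y < x \<and> 0 < y"
    using order_tendstoD(1)[OF f_at_0, of 0] eventually_at_right_real[OF that]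
    by (auto elim: eventually_elim2)
  then obtain y where "0 < f y / y" "y < x" "0 < y"
    using eventually_happens'[OF trivial_limit_at_right_real] by blast
  moreover from this have "f y \<le> f x"
    by (intro mono_onD[OF f_mono]) auto
  ultimately show ?thesis by (auto simp: zero_less_divide_iff)
qed

text \<open>Near 0 the ratio \<open>f x / x\<close> is below 2; from the threshold \<open>d\<close>
  on, \<open>f x \<le> 1 \<le> x / d\<close>. The slope \<open>2 + 1 / d\<close> covers both
  ranges.\<close>

lemma f_le_linear: "\<exists>C>0. \<forall>x>0. f x \<le> C * x"
proof -
  have "\<forall>\<^sub>F y in at_right 0. f y / y < 2"
    using order_tendstoD(2)[OF f_at_0, of 2] by simp
  then obtain d where d: "0 < d" "\<And>y. 0 < y \<Longrightarrow> y < d \<Longrightarrow> f y / y < 2"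
    by (auto simp: eventually_at_right_field)
  have "f x \<le> (2 + 1 / d) * x" if "0 < x" for x
  proof (cases "x < d")
    case True
    then have "f x \<le> 2 * x" using d(2)[of x] that by (simp add: field_simps)
    also have "\<dots> \<le> (2 + 1 / d) * x" using d that by (simp add: field_simps)
    finally show ?thesis .
  next
    case False
    have "f x \<le> 1" using that by (intro f_le_1) simp
    also have "1 \<le> 1 / d * x" using False d by (simp add: field_simps)
    also have "\<dots> \<le> (2 + 1 / d) * x" using d that by (intro mult_right_mono) auto
    finally show ?thesis .
  qed
  then show ?thesis using d by (intro exI[of _ "2 + 1 / d"]) (auto intro: add_pos_pos)
qed

lemma continuous_f_compose:
  "continuous_on S g \<Longrightarrow> (\<And>x. x \<in> S \<Longrightarrow> 0 \<le> g x) \<Longrightarrow> continuous_on S (\<lambda>x. f (g x))"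
  using f_cont by (rule continuous_on_compose2) auto

lemma measurable_j_fun[measurable]: "j_fun \<tau> f \<in> borel_measurable borel"
  unfolding j_fun_def
  by (intro borel_measurable_continuous_onI continuous_intros continuous_f_compose) auto

lemma j_fun_pos: "0 < j_fun \<tau> f u"
  by (simp add: j_fun_def f_pos)

lemma j_fun_le_exp: "j_fun \<tau> f u \<le> exp (- ((\<tau> - 1) / 2) * u)"
  using f_le_1[of "exp u"] by (simp add: j_fun_def mult_left_le)

text \<open>For positive \<open>u\<close> the bound \<open>f \<le> 1\<close> leaves decay at rate
  \<open>a = (\<tau> - 1) / 2\<close>. For negative \<open>u\<close> the linear bound on
  \<open>f\<close> contributes a factor \<open>exp u\<close>, which beats the growing factor
  \<open>exp (- a * u)\<close> with the margin \<open>b = 1 - a = (3 - \<tau>) / 2\<close>, positive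
  because \<open>\<tau> < 3\<close>.\<close>

lemma nn_integral_j_fun_finite: "(\<integral>\<^sup>+u. ennreal (j_fun \<tau> f u) \<partial>lborel) < \<top>"
proof -
  obtain C where C: "0 < C" "\<And>x. 0 < x \<Longrightarrow> f x \<le> C * x"
    using f_le_linear by auto
  define a b where "a = (\<tau> - 1) / 2" and "b = (3 - \<tau>) / 2"
  have ab: "0 < a" "0 < b" using tau by (auto simp: a_def b_def)
  let ?e1 = "\<lambda>u. ennreal (exp (- a * (u - 0))) * indicator {0..} u"
  let ?e2 = "\<lambda>u. ennreal (exp (- b * (u - 0))) * indicator {0..} u"
  have "(\<integral>\<^sup>+u. ennreal (j_fun \<tau> f u) \<partial>lborel) \<le> (\<integral>\<^sup>+u. ?e1 u + ennreal C * ?e2 (- u) \<partial>lborel)"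
  proof (intro nn_integral_mono)
    fix u :: real
    show "ennreal (j_fun \<tau> f u) \<le> ?e1 u + ennreal C * ?e2 (- u)"
    proof (cases "0 \<le> u")
      case True
      have "ennreal (j_fun \<tau> f u) \<le> ?e1 u"
        using True j_fun_le_exp[of u] by (auto simp: a_def intro!: ennreal_leI)
      then show ?thesis using add_increasing2 by (metis zero_le)
    next
      case False
      have "j_fun \<tau> f u \<le> exp (- (1 / 2) * (\<tau> - 1) * u) * (C * exp u)"
        unfolding j_fun_def by (intro mult_left_mono C) auto
      also have "\<dots> = C * exp (b * u)"
        by (simp add: b_def exp_add[symmetric] field_simps)
      finally have "ennreal (j_fun \<tau> f u) \<le> ennreal C * ?e2 (- u)"
        using False C(1) by (auto simp: ennreal_mult[symmetric] intro!: ennreal_leI)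
      then show ?thesis using False by simp
    qed
  qed
  also have "\<dots> = (\<integral>\<^sup>+u. ?e1 u \<partial>lborel) + ennreal C * (\<integral>\<^sup>+u. ?e2 (- u) \<partial>lborel)"
    by (subst nn_integral_add) (auto simp: nn_integral_cmult)
  also have "(\<integral>\<^sup>+u. ?e2 (- u) \<partial>lborel) = (\<integral>\<^sup>+u. ?e2 u \<partial>lborel)"
    using nn_integral_real_affine[of ?e2 "-1" 0] by simp
  also have "(\<integral>\<^sup>+u. ?e1 u \<partial>lborel) + ennreal C * (\<integral>\<^sup>+u. ?e2 u \<partial>lborel)
      = ennreal (1 / a) + ennreal C * ennreal (1 / b)"
    by (simp only: nn_integral_exp_atLeast ab)
  also have "\<dots> < \<top>" by (simp add: ennreal_mult[symmetric] ennreal_mult_less_top)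
  finally show ?thesis .
qed

lemma F_fun_circ:
  assumes "2 \<le> k"
  shows "ennreal (F_fun \<tau> f k (mat_vec k (circ k) t)) = cyc_prod (\<lambda>u. ennreal (j_fun \<tau> f u)) k t"
  using assms by (simp add: F_fun_def cyc_prod_def mat_vec_circ prod_ennreal less_imp_le[OF j_fun_pos])

text \<open>Instance of the abstract ratio lemma. The condition \<open>fin\<close> is discharged
  later, by identifying the orthant integral with a multiple of the probability of a cycle.\<close>

lemma orthant_cube_ratio:
  assumes A: "incseq A" "filterlim A at_top sequentially"
    and fin: "\<forall>\<^sub>F n in sequentially. (\<integral>\<^sup>+t. cyc_prod (\<lambda>u. ennreal (j_fun \<tau> f u)) k t
        * indicator (orthant k (A n)) t \<partial>Pi\<^sub>M {..<k} (\<lambda>_. lborel)) < \<top>"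
  shows "(\<lambda>n. enn2real (\<integral>\<^sup>+t. cyc_prod (\<lambda>u. ennreal (j_fun \<tau> f u)) k t
                * indicator (orthant k (A n)) t \<partial>Pi\<^sub>M {..<k} (\<lambda>_. lborel))
            / enn2real (\<integral>\<^sup>+t. cyc_prod (\<lambda>u. ennreal (j_fun \<tau> f u)) k t
                * indicator (cube k (A n)) t \<partial>Pi\<^sub>M {..<k} (\<lambda>_. lborel))) \<longlonglongrightarrow> 1"
proof -
  let ?P = "Pi\<^sub>M {..<k} (\<lambda>_. lborel :: real measure)"
  let ?\<Phi> = "cyc_prod (\<lambda>u. ennreal (j_fun \<tau> f u)) k"
  let ?c = "(\<tau> - 1) / 2"
  have meas[measurable]: "?\<Phi> \<in> borel_measurable ?P" by measurable
  have c: "0 < ?c" using tau by simp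
  have split: "?\<Phi> t * indicator (orthant k (A n)) t
      = ?\<Phi> t * indicator (cube k (A n)) t + ?\<Phi> t * indicator (orthant k (A n) - cube k (A n)) t" for n t
  proof -
    have "cube k (A n) \<subseteq> orthant k (A n)" by (intro PiE_mono) auto
    then show ?thesis by (auto simp: indicator_def)
  qed
  show ?thesis
  proof (rule ratio_tendsto_1_of_bounded_tail[OF _ fin])
    show "(\<lambda>n. \<integral>\<^sup>+t. ?\<Phi> t * indicator (cube k (A n)) t \<partial>?P) \<longlonglongrightarrow> (\<integral>\<^sup>+t. ?\<Phi> t \<partial>?P)"
      by (rule tendsto_cube_nn_integral[OF meas A])
    show J: "(\<integral>\<^sup>+t. ?\<Phi> t * indicator (orthant k (A n)) t \<partial>?P)
        = (\<integral>\<^sup>+t. ?\<Phi> t * indicator (cube k (A n)) t \<partial>?P)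
          + (\<integral>\<^sup>+t. ?\<Phi> t * indicator (orthant k (A n) - cube k (A n)) t \<partial>?P)" for n
      unfolding split by (rule nn_integral_add) measurable
    show "(\<integral>\<^sup>+t. ?\<Phi> t * indicator (cube k (A n)) t \<partial>?P)
          + (\<integral>\<^sup>+t. ?\<Phi> t * indicator (orthant k (A n) - cube k (A n)) t \<partial>?P) \<le> (\<integral>\<^sup>+t. ?\<Phi> t \<partial>?P)" for n
      unfolding J[symmetric] by (intro nn_integral_mono) (auto simp: indicator_def)
    show "(\<integral>\<^sup>+t. ?\<Phi> t * indicator (orthant k (A n) - cube k (A n)) t \<partial>?P)
        \<le> of_nat k * ((\<integral>\<^sup>+u. ennreal (j_fun \<tau> f u) \<partial>lborel) ^ (k - 1) * ennreal (1 / ?c))" for n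
      using j_fun_le_exp by (intro nn_integral_orthant_minus_cube_le c ennreal_leI) auto
    show "of_nat k * ((\<integral>\<^sup>+u. ennreal (j_fun \<tau> f u) \<partial>lborel) ^ (k - 1) * ennreal (1 / ?c)) < \<top>"
      using nn_integral_j_fun_finite by (simp add: ennreal_mult_less_top power_less_top_ennreal of_nat_less_top)
    have pos: "?\<Phi> t \<noteq> 0" for t
      using j_fun_pos by (simp add: cyc_prod_def ennreal_eq_0_iff not_le)
    \<comment> \<open>An integrand that vanishes nowhere can have integral 0 only on a null
      space.\<close>
    show "0 < (\<integral>\<^sup>+t. ?\<Phi> t \<partial>?P)"
    proof (rule ccontr)
      assume "\<not> 0 < (\<integral>\<^sup>+t. ?\<Phi> t \<partial>?P)"
      then have "AE t in ?P. ?\<Phi> t = 0"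
        by (simp add: nn_integral_0_iff_AE)
      then have "AE t in ?P. False" using pos by simp
      then have "emeasure ?P (space ?P) = 0"
        by (simp add: AE_iff_measurable[OF sets.top])
      then show False
        using emeasure_Pi_lborel_space_pos[of k] by (simp add: space_PiM)
    qed
  qed
qed

end

section \<open>Logarithmic change of variables\<close>

text \<open>The substitution is made on the compact intervals with ends \<open>c * exp (- n)\<close>
  and \<open>c * exp n\<close>, which correspond to \<open>{- n..n}\<close> in the logarithmic
  variable; monotone convergence on both sides then gives the whole half-line.\<close>

lemma nn_integral_lborel_exp_subst:
  fixes \<phi> :: "real \<Rightarrow> ennreal"
  assumes [measurable]: "\<phi> \<in> borel_measurable borel" and "0 < c"
  shows "(\<integral>\<^sup>+h. \<phi> h * indicator {0<..} h \<partial>lborel)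
         = (\<integral>\<^sup>+t. \<phi> (c * exp t) * ennreal (c * exp t) \<partial>lborel)"
proof -
  let ?I = "\<lambda>n::nat. {c * exp (- real n)..c * exp (real n)}"
  have pos: "0 < c * exp t" for t using \<open>0 < c\<close> by simp
  have "(\<lambda>n. \<integral>\<^sup>+h. \<phi> h * indicator (?I n) h \<partial>lborel)
      \<longlonglongrightarrow> (\<integral>\<^sup>+h. \<phi> h * indicator {0<..} h \<partial>lborel)"
  proof (rule nn_integral_LIMSEQ)
    have "?I m \<subseteq> ?I n" if "m \<le> n" for m n
      using that \<open>0 < c\<close> by (simp add: atLeastatMost_subset_iff)
    then have "(indicator (?I m) h :: ennreal) \<le> indicator (?I n) h" if "m \<le> n" for m n h
      using that by (meson indicator_leI subsetD)
    then show "incseq (\<lambda>n h. \<phi> h * indicator (?I n) h)"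
      by (intro monoI le_funI mult_left_mono) auto
    show "(\<lambda>h. \<phi> h * indicator (?I n) h) \<in> borel_measurable lborel" for n
      by measurable
    fix h :: real
    have "\<forall>\<^sub>F n in sequentially. (indicator (?I n) h :: ennreal) = indicator {0<..} h"
    proof (cases "0 < h")
      case True
      have "\<forall>\<^sub>F n in sequentially. \<bar>ln (h / c)\<bar> \<le> real n"
        by (rule eventually_sequentiallyI[of "nat \<lceil>\<bar>ln (h / c)\<bar>\<rceil>"]) linarith
      then show ?thesis
      proof eventually_elim
        case (elim n)
        then have "- real n \<le> ln (h / c)" "ln (h / c) \<le> real n" by linarith+
        then have "exp (- real n) \<le> h / c" "h / c \<le> exp (real n)"
          using True \<open>0 < c\<close> by (metis divide_pos_pos exp_le_cancel_iff exp_ln)+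
        then have "h \<in> ?I n" using \<open>0 < c\<close> by (simp add: field_simps)
        with True show ?case by simp
      qed
    next
      case False
      then have "h \<notin> ?I n" for n
        using less_le_trans[OF pos, of "- real n" h] by auto
      with False show ?thesis by simp
    qed
    then show "(\<lambda>n. \<phi> h * indicator (?I n) h) \<longlonglongrightarrow> \<phi> h * indicator {0<..} h"
      by (intro tendsto_eventually) (auto elim!: eventually_mono)
  qed
  moreover have "(\<integral>\<^sup>+h. \<phi> h * indicator (?I n) h \<partial>lborel)
      = (\<integral>\<^sup>+t. \<phi> (c * exp t) * ennreal (c * exp t) * indicator {- real n..real n} t \<partial>lborel)" for n
  proof (cases "n = 0")
    \<comment> \<open>Both intervals shrink to a point and both integrals vanish, so the
      substitution rule only has to handle nondegenerate intervals.\<close>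
    case True
    have *: "(\<integral>\<^sup>+x. \<psi> x * indicator {a} x \<partial>lborel) = 0" for \<psi> :: "real \<Rightarrow> ennreal" and a :: real
    proof -
      have "AE x in lborel. \<psi> x * indicator {a} x = 0"
        using AE_lborel_singleton[of a] by eventually_elim simp
      then have "(\<integral>\<^sup>+x. \<psi> x * indicator {a} x \<partial>lborel) = integral\<^sup>N lborel (\<lambda>x::real. 0)"
        by (rule nn_integral_cong_AE)
      then show ?thesis by simp
    qed
    show ?thesis using True by (simp add: *)
  next
    case False
    show ?thesis
      using False \<open>0 < c\<close>
      by (subst nn_integral_substitution_aux[where g' = "\<lambda>t. c * exp t"])
        (auto intro!: derivative_eq_intros continuous_intros)
  qed
  moreover have "(\<lambda>n. \<integral>\<^sup>+t. \<phi> (c * exp t) * ennreal (c * exp t) * indicator {- real n..real n} t \<partial>lborel)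
      \<longlonglongrightarrow> (\<integral>\<^sup>+t. \<phi> (c * exp t) * ennreal (c * exp t) \<partial>lborel)"
  proof (rule nn_integral_LIMSEQ)
    have "(indicator {- real m..real m} t :: ennreal) \<le> indicator {- real n..real n} t" if "m \<le> n" for m n t
      using that by (auto simp: indicator_def)
    then show "incseq (\<lambda>n t. \<phi> (c * exp t) * ennreal (c * exp t) * indicator {- real n..real n} t)"
      by (intro monoI le_funI mult_left_mono) auto
    show "(\<lambda>t. \<phi> (c * exp t) * ennreal (c * exp t) * indicator {- real n..real n} t)
        \<in> borel_measurable lborel" for n
      by measurable
    fix t :: real
    have "\<forall>\<^sub>F n in sequentially. \<bar>t\<bar> \<le> real n"
      by (rule eventually_sequentiallyI[of "nat \<lceil>\<bar>t\<bar>\<rceil>"]) linarith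
    then have "\<forall>\<^sub>F n in sequentially. t \<in> {- real n..real n}"
      by eventually_elim auto
    then show "(\<lambda>n. \<phi> (c * exp t) * ennreal (c * exp t) * indicator {- real n..real n} t)
        \<longlonglongrightarrow> \<phi> (c * exp t) * ennreal (c * exp t)"
      by (intro tendsto_eventually) (auto elim!: eventually_mono)
  qed
  ultimately show ?thesis
    using LIMSEQ_unique by simp
qed

text \<open>A one-dimensional change of variables, given as an identity of integrals, passes to
  finite products by Fubini and induction on the index set. \<open>W\<close> may live on a subspace
  of the line; therefore \<open>\<Phi>\<close> is taken measurable for products of
  \<open>borel\<close>, and \<open>id\<close> transfers this to \<open>W\<close>.\<close>

lemma nn_integral_PiM_subst:
  fixes \<Phi> :: "('i \<Rightarrow> real) \<Rightarrow> ennreal" and c :: "real \<Rightarrow> real"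
  assumes W: "sigma_finite_measure W" and N: "sigma_finite_measure N"
    and id: "(\<lambda>x. x) \<in> borel_measurable W"
    and c[measurable]: "c \<in> borel_measurable N"
    and w[measurable]: "w \<in> borel_measurable N"
    and subst: "\<And>g. g \<in> borel_measurable borel \<Longrightarrow> (\<integral>\<^sup>+x. g x \<partial>W) = (\<integral>\<^sup>+s. w s * g (c s) \<partial>N)"
    and "finite I" and "\<Phi> \<in> borel_measurable (Pi\<^sub>M I (\<lambda>_. borel))"
  shows "(\<integral>\<^sup>+x. \<Phi> x \<partial>Pi\<^sub>M I (\<lambda>_. W))
         = (\<integral>\<^sup>+t. (\<Prod>i\<in>I. w (t i)) * \<Phi> (\<lambda>i\<in>I. c (t i)) \<partial>Pi\<^sub>M I (\<lambda>_. N))"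
  using assms(7,8)
proof (induction I arbitrary: \<Phi> rule: finite_induct)
  case empty
  show ?case by (simp add: PiM_empty nn_integral_count_space_finite)
next
  case (insert i I)
  interpret W: product_sigma_finite "\<lambda>_::'i. W" using W by unfold_locales (auto simp: sigma_finite_measure_def)
  interpret N: product_sigma_finite "\<lambda>_::'i. N" using N by unfold_locales (auto simp: sigma_finite_measure_def)
  note \<Phi>[measurable] = insert.prems
  have "(\<lambda>x. x) \<in> measurable (Pi\<^sub>M (insert i I) (\<lambda>_. W)) (Pi\<^sub>M (insert i I) (\<lambda>_. borel))"
    by (rule measurable_PiM_single') (use id in \<open>auto simp: space_PiM PiE_iff intro: measurable_compose[OF measurable_component_singleton]\<close>)
  from measurable_compose[OF this \<Phi>]
  have \<Phi>W: "\<Phi> \<in> borel_measurable (Pi\<^sub>M (insert i I) (\<lambda>_. W))" .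
  \<comment> \<open>\<open>\<Psi>\<close> is \<open>\<Phi>\<close> with the new coordinate already
    substituted and integrated out; the induction hypothesis is applied to it.\<close>
  define \<Psi> where "\<Psi> x = (\<integral>\<^sup>+s. w s * \<Phi> (x(i := c s)) \<partial>N)" for x
  have upd: "(\<lambda>p. (fst p)(i := c (snd p))) \<in> measurable (Pi\<^sub>M I (\<lambda>_. borel) \<Otimes>\<^sub>M N) (Pi\<^sub>M (insert i I) (\<lambda>_. borel))"
    by (rule measurable_fun_upd[where J = I]) auto
  have [measurable]: "\<Psi> \<in> borel_measurable (Pi\<^sub>M I (\<lambda>_. borel))"
    unfolding \<Psi>_def
    using measurable_compose[OF upd \<Phi>]
    by (intro sigma_finite_measure.borel_measurable_nn_integral[OF N]) (simp add: case_prod_beta')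
  have cmeas: "(\<lambda>t. \<lambda>j\<in>insert i I. c (t j)) \<in> measurable (Pi\<^sub>M (insert i I) (\<lambda>_. N)) (Pi\<^sub>M (insert i I) (\<lambda>_. borel))"
    by measurable
  have comp[measurable]: "(\<lambda>t. (\<Prod>j\<in>insert i I. w (t j)) * \<Phi> (\<lambda>j\<in>insert i I. c (t j)))
      \<in> borel_measurable (Pi\<^sub>M (insert i I) (\<lambda>_. N))"
    using measurable_compose[OF cmeas \<Phi>] by measurable
  have "(\<integral>\<^sup>+x. \<Phi> x \<partial>Pi\<^sub>M (insert i I) (\<lambda>_. W)) = (\<integral>\<^sup>+x. (\<integral>\<^sup>+y. \<Phi> (x(i := y)) \<partial>W) \<partial>Pi\<^sub>M I (\<lambda>_. W))"
    using insert.hyps \<Phi>W by (rule W.product_nn_integral_insert)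
  also have "\<dots> = (\<integral>\<^sup>+x. \<Psi> x \<partial>Pi\<^sub>M I (\<lambda>_. W))"
  proof (intro nn_integral_cong)
    fix x assume "x \<in> space (Pi\<^sub>M I (\<lambda>_. W))"
    then have x: "x \<in> space (Pi\<^sub>M I (\<lambda>_. borel :: real measure))"
      by (auto simp: space_PiM PiE_iff)
    have "(\<lambda>y. x(i := y)) \<in> measurable borel (Pi\<^sub>M (insert i I) (\<lambda>_. borel))"
      using x by (intro measurable_fun_upd[where J = I]) auto
    then have "(\<lambda>y. \<Phi> (x(i := y))) \<in> borel_measurable borel"
      using \<Phi> by (rule measurable_compose)
    then show "(\<integral>\<^sup>+y. \<Phi> (x(i := y)) \<partial>W) = \<Psi> x"
      unfolding \<Psi>_def by (rule subst)
  qed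
  also have "\<dots> = (\<integral>\<^sup>+t. (\<Prod>j\<in>I. w (t j)) * \<Psi> (\<lambda>j\<in>I. c (t j)) \<partial>Pi\<^sub>M I (\<lambda>_. N))"
    by (rule insert.IH) measurable
  also have "\<dots> = (\<integral>\<^sup>+t. (\<integral>\<^sup>+s. (\<Prod>j\<in>I. w (t j)) * (w s * \<Phi> ((\<lambda>j\<in>I. c (t j))(i := c s))) \<partial>N) \<partial>Pi\<^sub>M I (\<lambda>_. N))"
  proof (intro nn_integral_cong)
    fix t assume "t \<in> space (Pi\<^sub>M I (\<lambda>_. N))"
    have "(\<lambda>s. (\<lambda>j\<in>I. c (t j))(i := c s)) \<in> measurable N (Pi\<^sub>M (insert i I) (\<lambda>_. borel))"
      by (intro measurable_fun_upd[where J = I]) (auto simp: space_PiM)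
    from measurable_compose[OF this \<Phi>]
    show "(\<Prod>j\<in>I. w (t j)) * \<Psi> (\<lambda>j\<in>I. c (t j))
        = (\<integral>\<^sup>+s. (\<Prod>j\<in>I. w (t j)) * (w s * \<Phi> ((\<lambda>j\<in>I. c (t j))(i := c s))) \<partial>N)"
      unfolding \<Psi>_def by (intro nn_integral_cmult[symmetric]) measurable
  qed
  also have "\<dots> = (\<integral>\<^sup>+t. (\<integral>\<^sup>+s. (\<Prod>j\<in>insert i I. w ((t(i := s)) j)) * \<Phi> (\<lambda>j\<in>insert i I. c ((t(i := s)) j)) \<partial>N)
      \<partial>Pi\<^sub>M I (\<lambda>_. N))"
  proof (intro nn_integral_cong)
    fix t :: "'i \<Rightarrow> _" and s
    have "(\<lambda>j\<in>I. c (t j))(i := c s) = (\<lambda>j\<in>insert i I. c ((t(i := s)) j))"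
      by (auto simp: fun_eq_iff)
    moreover have "(\<Prod>j\<in>insert i I. w ((t(i := s)) j)) = w s * (\<Prod>j\<in>I. w (t j))"
      using insert.hyps by (auto intro!: arg_cong2[where f = "(*)"] prod.cong)
    ultimately show "(\<Prod>j\<in>I. w (t j)) * (w s * \<Phi> ((\<lambda>j\<in>I. c (t j))(i := c s)))
        = (\<Prod>j\<in>insert i I. w ((t(i := s)) j)) * \<Phi> (\<lambda>j\<in>insert i I. c ((t(i := s)) j))"
      by (simp add: ac_simps)
  qed
  also have "\<dots> = (\<integral>\<^sup>+t. (\<Prod>j\<in>insert i I. w (t j)) * \<Phi> (\<lambda>j\<in>insert i I. c (t j)) \<partial>Pi\<^sub>M (insert i I) (\<lambda>_. N))"
    using insert.hyps comp by (rule N.product_nn_integral_insert[symmetric])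
  finally show ?case .
qed

section \<open>The Pareto weight law and its logarithmic form\<close>

lemma nn_integral_weight_law:
  assumes "g \<in> borel_measurable (restrict_space lborel {1..})"
  shows "(\<integral>\<^sup>+x. g x \<partial>weight_law \<tau>)
         = (\<integral>\<^sup>+x. ennreal ((\<tau> - 1) * x powr - \<tau>) * g x * indicator {1..} x \<partial>lborel)"
proof -
  have "(\<lambda>h. ennreal ((\<tau> - 1) * h powr - \<tau>)) \<in> borel_measurable (restrict_space lborel {1..})"
    by (intro measurable_restrict_space1) measurable
  then show ?thesis
    unfolding weight_law_def using assms
    by (simp add: nn_integral_density nn_integral_restrict_space)
qed

lemma sets_weight_law[measurable_cong]: "sets (weight_law \<tau>) = sets (restrict_space lborel {1..})"
  by (simp add: weight_law_def)

lemma space_weight_law: "space (weight_law \<tau>) = {1..}"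
  by (simp add: weight_law_def space_restrict_space)

lemma prob_space_weight_law:
  assumes "1 < \<tau>"
  shows "prob_space (weight_law \<tau>)"
proof
  let ?F = "\<lambda>x. - (x powr (1 - \<tau>))"
  have "emeasure (weight_law \<tau>) (space (weight_law \<tau>)) = (\<integral>\<^sup>+x. 1 \<partial>weight_law \<tau>)"
    by simp
  also have "\<dots> = (\<integral>\<^sup>+x. ennreal ((\<tau> - 1) * x powr - \<tau>) * indicator {1..} x \<partial>lborel)"
    by (subst nn_integral_weight_law) auto
  also have "\<dots> = ennreal (0 - ?F 1)"
  proof (rule nn_integral_FTC_atLeast[where F = ?F])
    show "((\<lambda>x. - (x powr (1 - \<tau>))) \<longlongrightarrow> 0) at_top"
      using tendsto_minus[OF tendsto_neg_powr[of "1 - \<tau>" "\<lambda>x. x" at_top]] assms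
      by (simp add: filterlim_ident)
    show "(?F has_real_derivative (\<tau> - 1) * x powr - \<tau>) (at x)" if "1 \<le> x" for x
      using that by (auto intro!: derivative_eq_intros simp: algebra_simps)
  qed (use assms in auto)
  finally show "emeasure (weight_law \<tau>) (space (weight_law \<tau>)) = 1" by simp
qed

text \<open>With \<open>x = c * exp s\<close> the density and the Jacobian combine to the power
  \<open>1 - \<tau>\<close> of \<open>x\<close>, and the support \<open>x \<ge> 1\<close> becomes
  \<open>s \<ge> - ln c\<close>. The constant in front, raised to the power \<open>k\<close>, is the
  prefactor of the asymptotics.\<close>

lemma nn_integral_weight_law_log:
  fixes g :: "real \<Rightarrow> ennreal"
  assumes [measurable]: "g \<in> borel_measurable borel" and "1 < \<tau>" "0 < c"
  shows "(\<integral>\<^sup>+x. g x \<partial>weight_law \<tau>)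
         = (\<integral>\<^sup>+s. ennreal (c powr (1 - \<tau>) * (\<tau> - 1) * exp (- (\<tau> - 1) * s)) * indicator {- ln c..} s * g (c * exp s) \<partial>lborel)"
proof -
  let ?\<phi> = "\<lambda>x. ennreal ((\<tau> - 1) * x powr - \<tau>) * g x * indicator {1..} x"
  have "(\<integral>\<^sup>+x. g x \<partial>weight_law \<tau>) = (\<integral>\<^sup>+x. ?\<phi> x \<partial>lborel)"
    by (intro nn_integral_weight_law measurable_restrict_space1) measurable
  also have "\<dots> = (\<integral>\<^sup>+x. ?\<phi> x * indicator {0<..} x \<partial>lborel)"
    by (intro nn_integral_cong) (auto simp: indicator_def)
  also have "\<dots> = (\<integral>\<^sup>+s. ?\<phi> (c * exp s) * ennreal (c * exp s) \<partial>lborel)"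
    using \<open>0 < c\<close> by (intro nn_integral_lborel_exp_subst) measurable
  also have "\<dots> = (\<integral>\<^sup>+s. ennreal (c powr (1 - \<tau>) * (\<tau> - 1) * exp (- (\<tau> - 1) * s)) * indicator {- ln c..} s * g (c * exp s) \<partial>lborel)"
  proof (intro nn_integral_cong)
    fix s :: real
    have ind: "(indicator {1..} (c * exp s) :: ennreal) = indicator {- ln c..} s"
    proof -
      have "1 \<le> c * exp s \<longleftrightarrow> 0 \<le> ln (c * exp s)"
        using \<open>0 < c\<close> by (simp add: ln_ge_zero_iff)
      also have "\<dots> \<longleftrightarrow> - ln c \<le> s"
        using \<open>0 < c\<close> by (simp add: ln_mult) linarith
      finally show ?thesis by (simp add: indicator_def)
    qed
    have "(\<tau> - 1) * (c * exp s) powr - \<tau> * (c * exp s) = (\<tau> - 1) * (c * exp s) powr (1 - \<tau>)"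
      using \<open>0 < c\<close> by (simp add: powr_diff powr_minus_divide)
    also have "\<dots> = c powr (1 - \<tau>) * (\<tau> - 1) * exp (- (\<tau> - 1) * s)"
      using \<open>0 < c\<close> by (simp add: powr_mult exp_powr_real mult_ac)
    finally have "ennreal ((\<tau> - 1) * (c * exp s) powr - \<tau>) * ennreal (c * exp s)
        = ennreal (c powr (1 - \<tau>) * (\<tau> - 1) * exp (- (\<tau> - 1) * s))"
      using \<open>0 < c\<close> \<open>1 < \<tau>\<close> by (simp add: ennreal_mult[symmetric])
    moreover have "?\<phi> (c * exp s) * ennreal (c * exp s)
        = ennreal ((\<tau> - 1) * (c * exp s) powr - \<tau>) * ennreal (c * exp s) * indicator {- ln c..} s * g (c * exp s)"
      unfolding ind by (simp only: mult_ac)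
    ultimately show "?\<phi> (c * exp s) * ennreal (c * exp s)
        = ennreal (c powr (1 - \<tau>) * (\<tau> - 1) * exp (- (\<tau> - 1) * s)) * indicator {- ln c..} s * g (c * exp s)"
      by simp
  qed
  finally show ?thesis .
qed

section \<open>Counting cycles in the complete graph\<close>

lemma finite_all_edges [simp]: "finite (all_edges n)"
  by (rule finite_subset[of _ "Pow {..<n}"]) (auto simp: all_edges_def)

definition cyc_edges :: "nat \<Rightarrow> (nat \<Rightarrow> 'a) \<Rightarrow> 'a set set" where
  "cyc_edges k v = (\<lambda>i. {v i, v (Suc i mod k)}) ` {..<k}"

lemma cyc_edges_restrict: "0 < k \<Longrightarrow> cyc_edges k (restrict v {..<k}) = cyc_edges k v"
  unfolding cyc_edges_def by (intro image_cong) auto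

lemma cycles_eq: "cycles k E = {cyc_edges k v | v. inj_on v {..<k} \<and> cyc_edges k v \<subseteq> E}"
  unfolding cycles_def cyc_edges_def by blast

lemma cycles_subset:
  assumes "E \<subseteq> A"
  shows "cycles k E = {c \<in> cycles k A. c \<subseteq> E}"
  unfolding cycles_eq using assms by blast

lemma Suc_mod_neq: "2 \<le> k \<Longrightarrow> i < k \<Longrightarrow> Suc i mod k \<noteq> i"
  by (cases "Suc i = k") auto

text \<open>\<open>cycles\<close> leaves \<open>v\<close> arbitrary outside \<open>{..<k}\<close>.
  Restricting to extensional functions keeps the edge sets and makes the labellings a finite set
  that can be counted.\<close>

lemma cycles_all_edges:
  assumes "2 \<le> k"
  shows "cycles k (all_edges n) = cyc_edges k ` {v \<in> {..<k} \<rightarrow>\<^sub>E {..<n}. inj_on v {..<k}}"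
proof -
  have k: "0 < k" using assms by simp
  have iff: "cyc_edges k v \<subseteq> all_edges n \<longleftrightarrow> (\<forall>i<k. v i < n)" if inj: "inj_on v {..<k}" for v
  proof -
    have "card {v i, v (Suc i mod k)} = 2" if "i < k" for i
      using inj_onD[OF inj, of i "Suc i mod k"] Suc_mod_neq[OF assms that] that k
      by (auto simp: card_insert_if)
    then show ?thesis
      using k by (auto simp: cyc_edges_def all_edges_def)
  qed
  show ?thesis
  proof (intro set_eqI iffI)
    fix c assume "c \<in> cycles k (all_edges n)"
    then obtain v where v: "c = cyc_edges k v" "inj_on v {..<k}" "\<forall>i<k. v i < n"
      using iff by (auto simp: cycles_eq)
    then have "restrict v {..<k} \<in> {v \<in> {..<k} \<rightarrow>\<^sub>E {..<n}. inj_on v {..<k}}"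
      by (auto simp: inj_on_def)
    then show "c \<in> cyc_edges k ` {v \<in> {..<k} \<rightarrow>\<^sub>E {..<n}. inj_on v {..<k}}"
      using v(1) cyc_edges_restrict[OF k, of v] by (metis image_eqI)
  next
    fix c assume "c \<in> cyc_edges k ` {v \<in> {..<k} \<rightarrow>\<^sub>E {..<n}. inj_on v {..<k}}"
    then show "c \<in> cycles k (all_edges n)"
      using iff by (auto simp: cycles_eq PiE_iff)
  qed
qed

lemma finite_cycles_all_edges:
  assumes "2 \<le> k"
  shows "finite (cycles k (all_edges n))"
  unfolding cycles_all_edges[OF assms] by (intro finite_imageI finite_Collect_conjI disjI1) (auto intro: finite_PiE)

text \<open>If two edges coincide at different indices, each index is the successor of the other
  modulo \<open>k\<close>, which forces \<open>k\<close> to divide 2. For \<open>k = 2\<close> the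
  two edges do coincide.\<close>

lemma inj_on_cyc_edge:
  assumes "3 \<le> k" and inj: "inj_on v {..<k}"
  shows "inj_on (\<lambda>i. {v i, v (Suc i mod k)}) {..<k}"
proof (rule inj_onI, rule ccontr)
  fix i j assume ij: "i \<in> {..<k}" "j \<in> {..<k}" "{v i, v (Suc i mod k)} = {v j, v (Suc j mod k)}" "i \<noteq> j"
  have k: "Suc i mod k < k" "Suc j mod k < k" using assms(1) by auto
  have "v i \<noteq> v j" using ij inj by (auto dest: inj_onD)
  with ij have "v i = v (Suc j mod k)" "v j = v (Suc i mod k)"
    by (auto simp: doubleton_eq_iff)
  then have eq: "i = Suc j mod k" "j = Suc i mod k"
    using ij k inj by (auto dest: inj_onD)
  have Suc_mod: "Suc l mod k = (if Suc l = k then 0 else Suc l)" if "l < k" for l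
    using that by simp
  have "i = (if Suc j = k then 0 else Suc j)" "j = (if Suc i = k then 0 else Suc i)"
    using eq Suc_mod[of i] Suc_mod[of j] ij(1,2) by (metis lessThan_iff)+
  then show False
    using assms(1) by presburger
qed

text \<open>On a cycle the only neighbours of \<open>W b\<close> are \<open>W (b + 1)\<close> and
  \<open>W (b - 1)\<close>. Integer indices avoid case distinctions at the wrap-around.\<close>

lemma edges_periodic_step:
  fixes V W :: "int \<Rightarrow> 'a"
  assumes W: "\<And>a b. W a = W b \<longleftrightarrow> a mod k = b mod k"
    and "{V z, V (z + 1)} \<in> range (\<lambda>z. {W z, W (z + 1)})"
    and "V z = W b"
  shows "V (z + 1) = W (b + 1) \<or> V (z + 1) = W (b - 1)"
proof -
  obtain w where "{V z, V (z + 1)} = {W w, W (w + 1)}"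
    using assms(2) by auto
  then consider "V z = W w" "V (z + 1) = W (w + 1)" | "V z = W (w + 1)" "V (z + 1) = W w"
    by (auto simp: doubleton_eq_iff)
  then show ?thesis
  proof cases
    case 1
    then have "b mod k = w mod k" using W assms(3) by metis
    then have "(b + 1) mod k = (w + 1) mod k" by (metis mod_add_left_eq)
    then show ?thesis using 1 W by metis
  next
    case 2
    then have "b mod k = (w + 1) mod k" using W assms(3) by metis
    then have "(b - 1) mod k = (w + 1 - 1) mod k" by (metis mod_diff_left_eq)
    then show ?thesis using 2 W by (metis add_diff_cancel_right')
  qed
qed

text \<open>The first edge fixes the starting point \<open>a\<close> and the direction
  \<open>s\<close>; a walk that may not turn back must then keep its direction.\<close>

lemma dihedral_of_same_edges:
  fixes V W :: "int \<Rightarrow> 'a" and k :: int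
  assumes "3 \<le> k"
    and V: "\<And>a b. V a = V b \<longleftrightarrow> a mod k = b mod k"
    and W: "\<And>a b. W a = W b \<longleftrightarrow> a mod k = b mod k"
    and edges: "\<And>z. {V z, V (z + 1)} \<in> range (\<lambda>z. {W z, W (z + 1)})"
  obtains a s where "s \<in> {1, -1}" "\<And>i::nat. V (int i) = W (a + s * int i)"
proof -
  obtain a where a: "V 0 = W a"
    using edges[of 0] by (auto simp: doubleton_eq_iff)
  obtain s :: int where s: "s \<in> {1, -1}" "V 1 = W (a + s)"
    using edges_periodic_step[where V = V and W = W and k = k, OF W edges a] by (metis add_0 diff_conv_add_uminus insertI1 insertI2)
  \<comment> \<open>Two consecutive positions are carried along, because excluding a turn requires
    the previous one.\<close>
  have "V (int i) = W (a + s * int i) \<and> V (int (Suc i)) = W (a + s * int (Suc i))" for i :: nat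
  proof (induction i)
    case 0
    show ?case using a s by simp
  next
    case (Suc i)
    let ?b = "a + s * int (Suc i)"
    \<comment> \<open>Turning back would identify the values of \<open>V\<close> at
      \<open>i + 2\<close> and \<open>i\<close>.\<close>
    have "V (int (Suc i) + 1) \<noteq> W (a + s * int i)"
    proof
      assume "V (int (Suc i) + 1) = W (a + s * int i)"
      then have "V (int (Suc i) + 1) = V (int i)" using Suc by simp
      then have "k dvd 2" using V by (simp add: mod_eq_dvd_iff)
      with \<open>3 \<le> k\<close> show False by (auto dest: zdvd_imp_le)
    qed
    moreover have "V (int (Suc i) + 1) = W (?b + s) \<or> V (int (Suc i) + 1) = W (?b - s)"
    proof -
      have "V (int (Suc i) + 1) = W (?b + 1) \<or> V (int (Suc i) + 1) = W (?b - 1)"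
        using edges_periodic_step[where V = V and W = W and k = k, OF W edges] Suc by blast
      then show ?thesis using s(1) by auto
    qed
    moreover have "?b - s = a + s * int i" "?b + s = a + s * int (Suc (Suc i))"
      by (simp_all add: algebra_simps)
    ultimately have "V (int (Suc i) + 1) = W (a + s * int (Suc (Suc i)))"
      by metis
    then show ?case using Suc by (simp add: add.commute)
  qed
  then show ?thesis using s(1) that by blast
qed

text \<open>On integer indices, changing the starting point and the orientation is the affine map
  sending \<open>z\<close> to \<open>a + s * z\<close>.\<close>

definition periodic :: "nat \<Rightarrow> (nat \<Rightarrow> 'a) \<Rightarrow> int \<Rightarrow> 'a" where
  "periodic k v z = v (nat (z mod int k))"

lemma periodic_eq_iff:
  assumes "0 < k" "inj_on v {..<k}"
  shows "periodic k v a = periodic k v b \<longleftrightarrow> a mod int k = b mod int k"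
  unfolding periodic_def
  using assms inj_onD[OF assms(2), of "nat (a mod int k)" "nat (b mod int k)"]
  by (auto simp: nat_less_iff eq_nat_nat_iff)

lemma cyc_edges_eq_range:
  assumes "0 < k"
  shows "cyc_edges k v = range (\<lambda>z. {periodic k v z, periodic k v (z + 1)})"
proof -
  have *: "{periodic k v z, periodic k v (z + 1)} = {v (nat (z mod int k)), v (Suc (nat (z mod int k)) mod k)}" for z
  proof -
    have "nat ((z + 1) mod int k) = nat ((z mod int k + 1) mod int k)"
      by (simp add: mod_add_left_eq)
    also have "\<dots> = Suc (nat (z mod int k)) mod k"
      using assms by (simp add: nat_mod_distrib nat_add_distrib)
    finally show ?thesis by (simp add: periodic_def)
  qed
  have "(\<lambda>z. nat (z mod int k)) ` UNIV = {..<k}"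
  proof (intro equalityI subsetI)
    fix i assume "i \<in> {..<k}"
    then show "i \<in> range (\<lambda>z. nat (z mod int k))"
      by (intro image_eqI[of _ _ "int i"]) auto
  qed (use assms in \<open>auto simp: nat_less_iff\<close>)
  then show ?thesis
    unfolding cyc_edges_def * by (metis (no_types, lifting) image_image image_cong)
qed

text \<open>The fibre is the orbit of \<open>w\<close> under the dihedral group: \<open>k\<close>
  starting points times two orientations, pairwise different because
  \<open>3 \<le> k\<close>.\<close>

lemma card_cyc_edges_fibre:
  assumes "3 \<le> k" and w: "w \<in> {..<k} \<rightarrow>\<^sub>E {..<n::nat}" "inj_on w {..<k}"
  shows "card {v \<in> {v \<in> {..<k} \<rightarrow>\<^sub>E {..<n}. inj_on v {..<k}}. cyc_edges k v = cyc_edges k w} = 2 * k"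
proof -
  let ?W = "periodic k w"
  define \<Theta> where "\<Theta> = (\<lambda>(a::int, s::int). \<lambda>i\<in>{..<k}. ?W (a + s * int i))"
  let ?D = "{0..<int k} \<times> {1, -1}"
  have k: "0 < k" using assms(1) by simp
  have W: "?W a = ?W b \<longleftrightarrow> a mod int k = b mod int k" for a b
    using periodic_eq_iff[OF k w(2)] .
  have Wn: "?W a < n" for a
    using w(1) k by (auto simp: periodic_def PiE_iff nat_less_iff)
  have per: "periodic k (\<Theta> (a, s)) z = ?W (a + s * z)" for a s z
  proof -
    have "periodic k (\<Theta> (a, s)) z = ?W (a + s * (z mod int k))"
      using k by (simp add: periodic_def \<Theta>_def nat_less_iff)
    also have "\<dots> = ?W (a + s * z)"
      unfolding W by (metis mod_add_right_eq mod_mult_right_eq)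
    finally show ?thesis .
  qed
  have inj\<Theta>: "inj_on (\<Theta> (a, s)) {..<k}" if "s \<in> {1, -1}" for a s
  proof (rule inj_onI)
    fix i j assume ij: "i \<in> {..<k}" "j \<in> {..<k}" "\<Theta> (a, s) i = \<Theta> (a, s) j"
    then have "int k dvd (a + s * int i) - (a + s * int j)"
      by (simp add: \<Theta>_def W mod_eq_dvd_iff)
    then have "int k dvd s * (int i - int j)" by (simp add: algebra_simps)
    then have "int k dvd int i - int j"
      using that by (auto simp: dvd_diff_commute)
    then have "int i mod int k = int j mod int k" by (simp add: mod_eq_dvd_iff)
    then show "i = j" using ij by simp
  qed
  have edges\<Theta>: "cyc_edges k (\<Theta> (a, s)) = cyc_edges k w" if "s \<in> {1, -1}" for a s
  proof -
    have reindex: "range (\<lambda>z. {?W (g z), ?W (g z + 1)}) = range (\<lambda>z. {?W z, ?W (z + 1)})"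
      if "surj g" for g :: "int \<Rightarrow> int"
    proof -
      have "range (\<lambda>z. {?W (g z), ?W (g z + 1)}) = (\<lambda>z. {?W z, ?W (z + 1)}) ` range g"
        by (simp only: image_image)
      then show ?thesis by (simp only: that)
    qed
    have "cyc_edges k (\<Theta> (a, s)) = range (\<lambda>z. {?W (a + s * z), ?W (a + s * (z + 1))})"
      by (simp add: cyc_edges_eq_range[OF k] per)
    also have "\<dots> = range (\<lambda>z. {?W z, ?W (z + 1)})"
    proof (cases "s = 1")
      case True
      have "surj (\<lambda>z. a + z)" by (rule surjI[of _ "\<lambda>z. z - a"]) simp
      from reindex[OF this] True show ?thesis by (simp add: add.assoc)
    next
      case False
      \<comment> \<open>For \<open>s = -1\<close> the edge joining \<open>a - z\<close> and
        \<open>a - (z + 1)\<close> is read from its lower end \<open>a - z - 1\<close>.\<close>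
      have "surj (\<lambda>z. a - z - 1)" by (rule surjI[of _ "\<lambda>z. a - z - 1"]) simp
      from reindex[OF this] False that show ?thesis
        by (simp add: insert_commute algebra_simps)
    qed
    finally show ?thesis by (simp add: cyc_edges_eq_range[OF k])
  qed
  have "{v \<in> {v \<in> {..<k} \<rightarrow>\<^sub>E {..<n}. inj_on v {..<k}}. cyc_edges k v = cyc_edges k w} = \<Theta> ` ?D"
  proof (intro equalityI subsetI)
    fix v assume "v \<in> \<Theta> ` ?D"
    then obtain a s where "v = \<Theta> (a, s)" "s \<in> {1, -1}" by auto
    then show "v \<in> {v \<in> {v \<in> {..<k} \<rightarrow>\<^sub>E {..<n}. inj_on v {..<k}}. cyc_edges k v = cyc_edges k w}"
      using inj\<Theta> edges\<Theta> Wn by (auto simp: \<Theta>_def)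
  next
    fix v assume "v \<in> {v \<in> {v \<in> {..<k} \<rightarrow>\<^sub>E {..<n}. inj_on v {..<k}}. cyc_edges k v = cyc_edges k w}"
    then have v: "v \<in> {..<k} \<rightarrow>\<^sub>E {..<n}" "inj_on v {..<k}" "cyc_edges k v = cyc_edges k w" by auto
    have edges: "{periodic k v z, periodic k v (z + 1)} \<in> range (\<lambda>z. {?W z, ?W (z + 1)})" for z
      using v(3) by (auto simp: cyc_edges_eq_range[OF k])
    have "3 \<le> int k" using assms(1) by simp
    from dihedral_of_same_edges[of "int k" "periodic k v" ?W, OF this periodic_eq_iff[OF k v(2)] W edges]
    obtain a s where s: "s \<in> {1, -1}" "\<And>i. periodic k v (int i) = ?W (a + s * int i)"
      by metis
    \<comment> \<open>The starting point is reduced modulo \<open>k\<close> to bring the pair into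
      \<open>?D\<close>.\<close>
    have "v = \<Theta> (a mod int k, s)"
    proof (rule PiE_ext[OF v(1)])
      fix i assume i: "i \<in> {..<k}"
      have "v i = periodic k v (int i)" using i by (simp add: periodic_def)
      also have "\<dots> = ?W (a mod int k + s * int i)"
        unfolding s(2) W by (simp add: mod_add_left_eq)
      finally show "v i = \<Theta> (a mod int k, s) i" using i by (simp add: \<Theta>_def)
    qed (use Wn in \<open>auto simp: \<Theta>_def\<close>)
    then show "v \<in> \<Theta> ` ?D" using s(1) k by auto
  qed
  moreover have "inj_on \<Theta> ?D"
  proof (rule inj_onI, clarify)
    fix a s b r assume as: "a \<in> {0..<int k}" "b \<in> {0..<int k}" "s \<in> {1, -1}" "r \<in> {1, -1}"
      and eq: "\<Theta> (a, s) = \<Theta> (b, r)"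
    have eqW: "?W (a + s * z) = ?W (b + r * z)" for z
      using per eq by metis
    from eqW[of 0] as have ab: "a = b" by (simp add: W)
    \<comment> \<open>The difference \<open>s - r\<close> is 0, 2 or -2, and
      \<open>3 \<le> k\<close> excludes the last two.\<close>
    from eqW[of 1] have "int k dvd s - r" by (simp add: W ab mod_eq_dvd_iff)
    moreover have "\<not> int k dvd 2"
      using assms(1) by (auto dest: zdvd_imp_le)
    ultimately have "s = r"
      using as by auto
    with ab show "a = b \<and> s = r" by simp
  qed
  ultimately show ?thesis
    by (simp add: card_image card_cartesian_product)
qed

text \<open>Injective labellings are counted twice: as a falling factorial, and through the fibres
  of \<open>cyc_edges\<close>, each of size \<open>2 * k\<close>. The product form avoids division
  of natural numbers.\<close>

lemma card_cycles_all_edges: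
  assumes "3 \<le> k"
  shows "2 * k * card (cycles k (all_edges n)) = (n choose k) * fact k"
proof -
  let ?I = "{v \<in> {..<k} \<rightarrow>\<^sub>E {..<n}. inj_on v {..<k}}"
  have fin: "finite ?I" by (intro finite_Collect_conjI disjI1) (auto intro: finite_PiE)
  have "card ?I = (\<Sum>c\<in>cyc_edges k ` ?I. card {v \<in> ?I. cyc_edges k v = c})"
    using sum.image_gen[OF fin, of "\<lambda>_. 1::nat" "cyc_edges k"] by (simp only: card_eq_sum)
  also have "\<dots> = (\<Sum>c\<in>cyc_edges k ` ?I. 2 * k)"
    using card_cyc_edges_fibre[OF assms] by (intro sum.cong) auto
  also have "\<dots> = 2 * k * card (cycles k (all_edges n))"
    using assms by (simp add: cycles_all_edges)
  finally have "2 * k * card (cycles k (all_edges n)) = card ?I" by simp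
  also have "\<dots> = (\<Prod>i=0..<k. n - i)"
    using card_inj_on_subset_funcset[of "{..<k}" "{..<n}" "{..<k}"] by simp
  also have "\<dots> = (n choose k) * fact k"
  proof (cases "k \<le> n")
    case True
    have "(\<Prod>i=0..<j. n - i) * fact (n - j) = (fact n :: nat)" if "j \<le> n" for j
      using that
    proof (induction j)
      case (Suc j)
      then have "(fact (n - j) :: nat) = (n - j) * fact (n - Suc j)"
        by (metis Suc_diff_Suc Suc_le_lessD fact_Suc of_nat_id)
      with Suc show ?case by (simp add: mult.assoc)
    qed simp
    from this[OF True] binomial_fact_lemma[OF True] show ?thesis
      by (metis fact_nonzero mult.assoc mult.commute mult_right_cancel)
  next
    \<comment> \<open>For \<open>k > n\<close> both sides are 0, on the left because of the factor
      with \<open>i = n\<close>.\<close>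
    case False
    then show ?thesis by (auto simp: prod_zero_iff binomial_eq_0 intro!: bexI[of _ n])
  qed
  finally show ?thesis .
qed

section \<open>Expected number of cycles\<close>

text \<open>The indicator of \<open>c \<subseteq> E\<close> is written as a product over all
  possible edges, with trivial factors off \<open>c\<close>, so that its expectation under a product
  law splits edge by edge.\<close>

lemma card_as_sum_prod:
  assumes "finite A" "finite \<C>" "\<And>c. c \<in> \<C> \<Longrightarrow> c \<subseteq> A"
  shows "ennreal (real (card {c \<in> \<C>. c \<subseteq> E})) = (\<Sum>c\<in>\<C>. \<Prod>e\<in>A. if e \<in> c then of_bool (e \<in> E) else 1)"
proof -
  have "(\<Prod>e\<in>A. if e \<in> c then of_bool (e \<in> E) else 1) = (of_bool (c \<subseteq> E) :: ennreal)" if "c \<in> \<C>" for c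
  proof (cases "c \<subseteq> E")
    case True
    then show ?thesis by (auto intro!: prod.neutral)
  next
    case False
    then obtain e where "e \<in> c" "e \<notin> E" by auto
    then show ?thesis
      using False assms(1) assms(3)[OF that] by (auto intro!: prod_zero bexI[of _ e])
  qed
  then have "(\<Sum>c\<in>\<C>. \<Prod>e\<in>A. if e \<in> c then of_bool (e \<in> E) else 1) = (\<Sum>c\<in>\<C>. of_bool (c \<subseteq> E) :: ennreal)"
    by (intro sum.cong) auto
  also have "\<dots> = of_nat (card {c \<in> \<C>. c \<subseteq> E})"
    using assms(2) by (simp add: sum.If_cases of_bool_def Int_def)
  finally show ?thesis by (simp add: ennreal_of_nat_eq_real_of_nat)
qed

text \<open>Linearity of expectation over the cycles of the complete graph, and conditional
  independence of the edges within one cycle.\<close>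

lemma nn_integral_graph_cycles:
  assumes "2 \<le> k"
    and p: "\<And>e. e \<in> all_edges n \<Longrightarrow> p (h (Min e)) (h (Max e)) \<in> {0..1}"
  shows "(\<integral>\<^sup>+E. ennreal (real (card (cycles k E))) \<partial>measure_pmf (graph_given_weights n p h))
         = (\<Sum>c\<in>cycles k (all_edges n). \<Prod>e\<in>c. ennreal (p (h (Min e)) (h (Max e))))"
proof -
  let ?A = "all_edges n" and ?C = "cycles k (all_edges n)"
  let ?q = "\<lambda>e. p (h (Min e)) (h (Max e))"
  let ?P = "Pi_pmf ?A False (\<lambda>e. bernoulli_pmf (?q e))"
  have sub: "c \<subseteq> ?A" if "c \<in> ?C" for c
    using that by (auto simp: cycles_eq)
  have "(\<integral>\<^sup>+E. ennreal (real (card (cycles k E))) \<partial>measure_pmf (graph_given_weights n p h))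
      = (\<integral>\<^sup>+x. ennreal (real (card (cycles k {e. x e}))) \<partial>?P)"
    by (simp add: graph_given_weights_def)
  also have "\<dots> = (\<integral>\<^sup>+x. (\<Sum>c\<in>?C. \<Prod>e\<in>?A. if e \<in> c then of_bool (x e) else 1) \<partial>?P)"
  proof (intro nn_integral_cong_AE AE_pmfI)
    \<comment> \<open>The default value \<open>False\<close> of the product law keeps every sampled
      edge set inside \<open>all_edges n\<close>.\<close>
    fix x assume "x \<in> set_pmf ?P"
    then have "{e. x e} \<subseteq> ?A"
      using set_Pi_pmf_subset[OF finite_all_edges, of n False] by blast
    then have "cycles k {e. x e} = {c \<in> ?C. c \<subseteq> {e. x e}}"
      by (rule cycles_subset)
    then show "ennreal (real (card (cycles k {e. x e})))
        = (\<Sum>c\<in>?C. \<Prod>e\<in>?A. if e \<in> c then of_bool (x e) else 1)"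
      using card_as_sum_prod[where E = "{e. x e}", OF finite_all_edges finite_cycles_all_edges[OF assms(1)] sub]
      by (simp only: mem_Collect_eq)
  qed
  also have "\<dots> = (\<Sum>c\<in>?C. \<integral>\<^sup>+x. (\<Prod>e\<in>?A. if e \<in> c then of_bool (x e) else 1) \<partial>?P)"
    by (intro nn_integral_sum) simp
  also have "\<dots> = (\<Sum>c\<in>?C. \<Prod>e\<in>c. ennreal (?q e))"
  proof (intro sum.cong refl)
    fix c assume c: "c \<in> ?C"
    have "(\<integral>\<^sup>+x. (\<Prod>e\<in>?A. if e \<in> c then of_bool (x e) else 1) \<partial>?P)
        = (\<Prod>e\<in>?A. \<integral>\<^sup>+b. (if e \<in> c then of_bool b else 1) \<partial>bernoulli_pmf (?q e))"
      by (rule nn_integral_prod_Pi_pmf) simp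
    also have "\<dots> = (\<Prod>e\<in>?A. if e \<in> c then ennreal (?q e) else 1)"
    proof (intro prod.cong refl)
      fix e assume "e \<in> ?A"
      then show "(\<integral>\<^sup>+b. (if e \<in> c then of_bool b else 1) \<partial>bernoulli_pmf (?q e))
          = (if e \<in> c then ennreal (?q e) else 1)"
        using p[of e]
        by (cases "e \<in> c") (auto simp: ennreal_plus[symmetric] simp del: ennreal_plus)
    qed
    also have "\<dots> = (\<Prod>e\<in>c. ennreal (?q e))"
      using sub[OF c] by (simp add: prod.If_cases Int_absorb1 flip: prod.inter_restrict)
    finally show "(\<integral>\<^sup>+x. (\<Prod>e\<in>?A. if e \<in> c then of_bool (x e) else 1) \<partial>?P) = (\<Prod>e\<in>c. ennreal (?q e))" .
  qed
  finally show ?thesis .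
qed

text \<open>Makes the mixture over the weights in \<open>inhom_random_graph\<close> a legitimate
  \<open>bind\<close>. Only finitely many graphs have positive mass, so the probability of any event
  is a finite sum of products of edge probabilities and their complements.\<close>

lemma measurable_graph_given_weights:
  assumes meas: "\<And>e. e \<in> all_edges n \<Longrightarrow> (\<lambda>h. p (h (Min e)) (h (Max e))) \<in> borel_measurable M"
    and p: "\<And>e h. e \<in> all_edges n \<Longrightarrow> h \<in> space M \<Longrightarrow> p (h (Min e)) (h (Max e)) \<in> {0..1}"
  shows "(\<lambda>h. measure_pmf (graph_given_weights n p h)) \<in> measurable M (subprob_algebra (count_space UNIV))"
proof (rule measurable_subprob_algebra)
  let ?S = "PiE_dflt (all_edges n) False (\<lambda>_. UNIV)"
  let ?P = "\<lambda>h. Pi_pmf (all_edges n) False (\<lambda>e. bernoulli_pmf (p (h (Min e)) (h (Max e))))"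
  show "subprob_space (measure_pmf (graph_given_weights n p h))" for h
    by (rule prob_space_imp_subprob_space) unfold_locales
  show "sets (measure_pmf (graph_given_weights n p h)) = sets (count_space UNIV)" for h
    by simp
  fix B :: "nat set set set"
  have "emeasure (measure_pmf (graph_given_weights n p h)) B
      = (\<Sum>x\<in>?S. indicator B {e. x e} * (\<Prod>e\<in>all_edges n. ennreal
          (if x e then p (h (Min e)) (h (Max e)) else 1 - p (h (Min e)) (h (Max e)))))"
    if h: "h \<in> space M" for h
  proof -
    have "emeasure (measure_pmf (graph_given_weights n p h)) B
        = (\<integral>\<^sup>+E. indicator B E \<partial>measure_pmf (graph_given_weights n p h))"
      by simp
    also have "\<dots> = (\<integral>\<^sup>+x. indicator B {e. x e} \<partial>?P h)"
      by (simp only: graph_given_weights_def nn_integral_map_pmf)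
    also have "\<dots> = (\<Sum>x\<in>?S. indicator B {e. x e} * ennreal (pmf (?P h) x))"
    proof (rule nn_integral_measure_pmf_support)
      fix x assume "x \<in> set_pmf (?P h)" "x \<notin> ?S"
      then show "indicator B {e. x e} = (0 :: ennreal)"
        using set_Pi_pmf_subset'[OF finite_all_edges, of n False] by (force simp: PiE_dflt_def)
    qed (auto intro!: finite_PiE_dflt)
    also have "\<dots> = (\<Sum>x\<in>?S. indicator B {e. x e} * (\<Prod>e\<in>all_edges n. ennreal
          (if x e then p (h (Min e)) (h (Max e)) else 1 - p (h (Min e)) (h (Max e)))))"
    proof (intro sum.cong refl arg_cong2[where f = "(*)"])
      fix x assume "x \<in> ?S"
      then have "pmf (?P h) x = (\<Prod>e\<in>all_edges n. pmf (bernoulli_pmf (p (h (Min e)) (h (Max e)))) (x e))"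
        by (intro pmf_Pi') (auto simp: PiE_dflt_def)
      then have "ennreal (pmf (?P h) x)
          = (\<Prod>e\<in>all_edges n. ennreal (pmf (bernoulli_pmf (p (h (Min e)) (h (Max e)))) (x e)))"
        by (simp add: prod_ennreal)
      also have "\<dots> = (\<Prod>e\<in>all_edges n. ennreal
          (if x e then p (h (Min e)) (h (Max e)) else 1 - p (h (Min e)) (h (Max e))))"
        using p[OF _ h] by (intro prod.cong) auto
      finally show "ennreal (pmf (?P h) x) = \<dots>" .
    qed
    finally show ?thesis .
  qed
  moreover have "(\<lambda>h. \<Sum>x\<in>?S. indicator B {e. x e} * (\<Prod>e\<in>all_edges n. ennreal
          (if x e then p (h (Min e)) (h (Max e)) else 1 - p (h (Min e)) (h (Max e)))))
      \<in> borel_measurable M"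
  proof (intro borel_measurable_sum borel_measurable_times_ennreal borel_measurable_const
      borel_measurable_prod_ennreal)
    fix x e assume "e \<in> all_edges n"
    from meas[OF this] show "(\<lambda>h. ennreal (if x e then p (h (Min e)) (h (Max e)) else 1 - p (h (Min e)) (h (Max e))))
      \<in> borel_measurable M"
      by (cases "x e") auto
  qed
  ultimately show "(\<lambda>h. emeasure (measure_pmf (graph_given_weights n p h)) B) \<in> borel_measurable M"
    by (simp cong: measurable_cong)
qed

lemma sum_mod_shift:
  fixes t :: "nat \<Rightarrow> 'a::comm_monoid_add"
  shows "(\<Sum>i<k. t (Suc i mod k)) = (\<Sum>i<k. t i)"
proof (cases "k = 0")
  case False
  then show ?thesis
    using sum.reindex_bij_betw[OF bij_betw_mod_shift[of k 1], of t] by simp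
qed simp

lemma prod_cyc_edges:
  assumes "3 \<le> k" "inj_on v {..<k}"
  shows "(\<Prod>e\<in>cyc_edges k v. g e) = (\<Prod>i<k. g {v i, v (Suc i mod k)})"
  unfolding cyc_edges_def by (simp add: prod.reindex[OF inj_on_cyc_edge[OF assms]])

lemma all_edges_Min_Max:
  assumes "e \<in> all_edges n"
  shows "Min e < n" "Max e < n"
proof -
  from assms obtain a b where "e = {a, b}" "a < n" "b < n"
    by (auto simp: all_edges_def card_2_iff)
  then show "Min e < n" "Max e < n" by auto
qed

text \<open>Any injective selection of i.i.d. coordinates has the same joint law; this is why all
  cycles have the same mean.\<close>

lemma nn_integral_PiM_reindex:
  assumes M: "prob_space M" and v: "inj_on v I" "v ` I \<subseteq> K"
    and [measurable]: "g \<in> borel_measurable (Pi\<^sub>M I (\<lambda>_. M))"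
  shows "(\<integral>\<^sup>+x. g (\<lambda>i\<in>I. x (v i)) \<partial>Pi\<^sub>M K (\<lambda>_. M)) = (\<integral>\<^sup>+x. g x \<partial>Pi\<^sub>M I (\<lambda>_. M))"
proof -
  have "(\<lambda>x. \<lambda>i\<in>I. x (v i)) \<in> measurable (Pi\<^sub>M K (\<lambda>_. M)) (Pi\<^sub>M I (\<lambda>_. M))"
    using v(2) by (intro measurable_restrict measurable_component_singleton) auto
  then have "(\<integral>\<^sup>+x. g (\<lambda>i\<in>I. x (v i)) \<partial>Pi\<^sub>M K (\<lambda>_. M))
      = (\<integral>\<^sup>+x. g x \<partial>distr (Pi\<^sub>M K (\<lambda>_. M)) (Pi\<^sub>M I (\<lambda>_. M)) (\<lambda>x. \<lambda>i\<in>I. x (v i)))"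
    by (simp add: nn_integral_distr)
  also have "\<dots> = (\<integral>\<^sup>+x. g x \<partial>Pi\<^sub>M I (\<lambda>_. M))"
    using distr_PiM_reindex[of K "\<lambda>_. M" v I] M v by (simp add: image_subset_iff_funcset)
  finally show ?thesis .
qed

context connection_kernel
begin

text \<open>Truncating the argument at 0 makes the kernel Borel measurable on the whole line without
  changing it on the products of weights.\<close>
definition kern :: "real \<Rightarrow> ennreal" where
  "kern x = ennreal (f (max 0 x))"

lemma measurable_kern[measurable]: "kern \<in> borel_measurable borel"
  unfolding kern_def
  by (intro measurable_compose[OF _ measurable_ennreal] borel_measurable_continuous_onI
      continuous_f_compose continuous_intros) auto

lemma kern_le_1: "kern x \<le> 1"
  using f_le_1[of "max 0 x"] by (simp add: kern_def)

text \<open>For \<open>c = \<gamma> \<tau> n\<close> this is the probability that one prescribed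
  \<open>k\<close>-cycle is present in the graph.\<close>

definition cycle_mean :: "nat \<Rightarrow> real \<Rightarrow> ennreal" where
  "cycle_mean k c = (\<integral>\<^sup>+h. (\<Prod>i<k. kern (h i * h (Suc i mod k) / c\<^sup>2)) \<partial>Pi\<^sub>M {..<k} (\<lambda>_. weight_law \<tau>))"

lemma prob_space_weights: "prob_space (Pi\<^sub>M I (\<lambda>_. weight_law \<tau>))"
  using tau by (intro prob_space_PiM prob_space_weight_law) simp

lemma measurable_id_weight_law: "(\<lambda>x. x) \<in> borel_measurable (weight_law \<tau>)"
  by (simp add: measurable_cong_sets[OF sets_weight_law refl] measurable_restrict_space1)

text \<open>This trivial bound is the source of the finiteness of the orthant integrals.\<close>

lemma cycle_mean_le_1: "cycle_mean k c \<le> 1"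
proof -
  interpret prob_space "Pi\<^sub>M {..<k} (\<lambda>_. weight_law \<tau>)" by (rule prob_space_weights)
  have "cycle_mean k c \<le> (\<integral>\<^sup>+h. 1 \<partial>Pi\<^sub>M {..<k} (\<lambda>_. weight_law \<tau>))"
    unfolding cycle_mean_def using kern_le_1 by (intro nn_integral_mono prod_le_1) auto
  then show ?thesis by (simp add: emeasure_space_1)
qed

lemma cycle_mean_eq:
  assumes "0 < c"
  shows "cycle_mean k c = ennreal ((c powr (1 - \<tau>) * (\<tau> - 1)) ^ k) *
    (\<integral>\<^sup>+t. cyc_prod (\<lambda>u. ennreal (j_fun \<tau> f u)) k t * indicator (orthant k (ln c)) t
       \<partial>Pi\<^sub>M {..<k} (\<lambda>_. lborel))"
proof -
  let ?K = "c powr (1 - \<tau>) * (\<tau> - 1)"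
  let ?w = "\<lambda>s. ennreal (?K * exp (- (\<tau> - 1) * s)) * indicator {- ln c..} s"
  let ?\<Phi> = "\<lambda>h. \<Prod>i<k. kern (h i * h (Suc i mod k) / c\<^sup>2)"
  have K: "0 < ?K" using assms tau by simp
  have \<Phi>: "?\<Phi> \<in> borel_measurable (Pi\<^sub>M {..<k} (\<lambda>_. borel))"
    by measurable
  have "cycle_mean k c = (\<integral>\<^sup>+t. (\<Prod>i<k. ?w (t i)) * ?\<Phi> (\<lambda>i\<in>{..<k}. c * exp (t i)) \<partial>Pi\<^sub>M {..<k} (\<lambda>_. lborel))"
    unfolding cycle_mean_def
  proof (rule nn_integral_PiM_subst)
    show "sigma_finite_measure (weight_law \<tau>)"
      using prob_space_weight_law[of \<tau>] tau
      by (simp add: prob_space_imp_sigma_finite)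
    show "(\<integral>\<^sup>+x. g x \<partial>weight_law \<tau>) = (\<integral>\<^sup>+s. ?w s * g (c * exp s) \<partial>lborel)"
      if "g \<in> borel_measurable borel" for g
      using nn_integral_weight_law_log[OF that _ assms, of \<tau>] tau by simp
  qed (use \<Phi> measurable_id_weight_law in \<open>auto intro: lborel.sigma_finite_measure_axioms\<close>)
  also have "\<dots> = (\<integral>\<^sup>+t. ennreal (?K ^ k) * (cyc_prod (\<lambda>u. ennreal (j_fun \<tau> f u)) k t
      * indicator (orthant k (ln c)) t) \<partial>Pi\<^sub>M {..<k} (\<lambda>_. lborel))"
  proof (intro nn_integral_cong)
    fix t :: "nat \<Rightarrow> real" assume "t \<in> space (Pi\<^sub>M {..<k} (\<lambda>_. lborel))"
    \<comment> \<open>Orthants contain extensional functions only; with this fact, leaving the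
      orthant means that some coordinate with \<open>i < k\<close> is too small, and then its weight
      factor vanishes.\<close>
    then have ext: "t \<in> extensional {..<k}" by (simp add: space_PiM PiE_iff)
    show "(\<Prod>i<k. ?w (t i)) * ?\<Phi> (\<lambda>i\<in>{..<k}. c * exp (t i))
        = ennreal (?K ^ k) * (cyc_prod (\<lambda>u. ennreal (j_fun \<tau> f u)) k t * indicator (orthant k (ln c)) t)"
    proof (cases "t \<in> orthant k (ln c)")
      case True
      then have "(\<Prod>i<k. ?w (t i)) = (\<Prod>i<k. ennreal (?K * exp (- (\<tau> - 1) * t i)))"
        by (intro prod.cong) (auto simp: PiE_iff)
      also have "\<dots> = ennreal (\<Prod>i<k. ?K * exp (- (\<tau> - 1) * t i))"
        using K by (intro prod_ennreal) simp
      finally have 1: "(\<Prod>i<k. ?w (t i)) = ennreal (\<Prod>i<k. ?K * exp (- (\<tau> - 1) * t i))" .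
      have "?\<Phi> (\<lambda>i\<in>{..<k}. c * exp (t i)) = (\<Prod>i<k. ennreal (f (exp (t i + t (Suc i mod k)))))"
      proof (intro prod.cong refl)
        fix i assume "i \<in> {..<k}"
        then have "Suc i mod k < k" by (cases k) auto
        then show "kern ((\<lambda>i\<in>{..<k}. c * exp (t i)) i * (\<lambda>i\<in>{..<k}. c * exp (t i)) (Suc i mod k) / c\<^sup>2)
            = ennreal (f (exp (t i + t (Suc i mod k))))"
          using \<open>i \<in> {..<k}\<close> assms by (simp add: kern_def power2_eq_square exp_add)
      qed
      also have "\<dots> = ennreal (\<Prod>i<k. f (exp (t i + t (Suc i mod k))))"
        by (intro prod_ennreal f_nonneg) simp
      finally have 2: "?\<Phi> (\<lambda>i\<in>{..<k}. c * exp (t i)) = ennreal (\<Prod>i<k. f (exp (t i + t (Suc i mod k))))" .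
      have 3: "cyc_prod (\<lambda>u. ennreal (j_fun \<tau> f u)) k t = ennreal (\<Prod>i<k. j_fun \<tau> f (t i + t (Suc i mod k)))"
        unfolding cyc_prod_def using j_fun_pos by (intro prod_ennreal less_imp_le)
      \<comment> \<open>Each coordinate occurs in two neighbouring sums, so two halves restore the
        full exponent at every vertex.\<close>
      have "(\<Sum>i<k. - (1 / 2) * (\<tau> - 1) * (t i + t (Suc i mod k))) = (\<Sum>i<k. - (\<tau> - 1) * t i)"
        by (simp only: sum_distrib_left[symmetric] sum.distrib sum_mod_shift) (simp add: field_simps)
      then have "(\<Prod>i<k. exp (- (1 / 2) * (\<tau> - 1) * (t i + t (Suc i mod k)))) = (\<Prod>i<k. exp (- (\<tau> - 1) * t i))"
        by (simp only: exp_sum[symmetric] finite_lessThan)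
      then have "(\<Prod>i<k. ?K * exp (- (\<tau> - 1) * t i)) * (\<Prod>i<k. f (exp (t i + t (Suc i mod k))))
          = ?K ^ k * (\<Prod>i<k. j_fun \<tau> f (t i + t (Suc i mod k)))"
        unfolding j_fun_def prod.distrib by (simp add: power_mult_distrib)
      then show ?thesis
        using True K unfolding 1 2 3
        by (simp add: ennreal_mult[symmetric] prod_nonneg f_nonneg less_imp_le[OF j_fun_pos])
    next
      case False
      then obtain i where "i < k" "t i \<notin> {- ln c..}"
        using ext by (auto simp: PiE_iff)
      then have "(\<Prod>i<k. ?w (t i)) = 0"
        by (intro prod_zero) (auto intro!: bexI[of _ i])
      then show ?thesis using False by simp
    qed
  qed
  also have "\<dots> = ennreal (?K ^ k) * (\<integral>\<^sup>+t. cyc_prod (\<lambda>u. ennreal (j_fun \<tau> f u)) k t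
      * indicator (orthant k (ln c)) t \<partial>Pi\<^sub>M {..<k} (\<lambda>_. lborel))"
    by (intro nn_integral_cmult) measurable
  finally show ?thesis .
qed

text \<open>All cycles of the complete graph contribute equally, so the expectation is their number
  times \<open>cycle_mean\<close>.\<close>

lemma avg_cycles_eq:
  assumes "3 \<le> k"
  shows "avg_cycles \<tau> f k n
         = 1 / (2 * real k) * real (n choose k) * fact k * enn2real (cycle_mean k (\<gamma> \<tau> n))"
proof -
  let ?g = "\<gamma> \<tau> n" and ?W = "Pi\<^sub>M {..<n} (\<lambda>_. weight_law \<tau>)"
  let ?p = "\<lambda>h h'. f (h * h' / (\<gamma> \<tau> n)\<^sup>2)"
  let ?G = "\<lambda>h. measure_pmf (graph_given_weights n ?p h)"
  let ?C = "cycles k (all_edges n)"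
  have k: "2 \<le> k" using assms by simp
  interpret W: prob_space ?W by (rule prob_space_weights)
  have comp: "(\<lambda>h. h i) \<in> borel_measurable (Pi\<^sub>M I (\<lambda>_. weight_law \<tau>))" if "i \<in> I" for i and I :: "nat set"
    using measurable_compose[OF measurable_component_singleton[OF that, of "\<lambda>_. weight_law \<tau>"]
        measurable_id_weight_law] .
  have pos: "0 \<le> h (Min e) * h (Max e) / ?g\<^sup>2" if "h \<in> space ?W" "e \<in> all_edges n" for h e
  proof -
    have "1 \<le> h i" if "i < n" for i
      using \<open>h \<in> space ?W\<close> that by (auto simp: space_PiM space_weight_law PiE_iff)
    then have "1 \<le> h (Min e)" "1 \<le> h (Max e)" using all_edges_Min_Max[OF that(2)] by auto
    then show ?thesis by simp
  qed
  have kern: "ennreal (?p (h (Min e)) (h (Max e))) = kern (h (Min e) * h (Max e) / ?g\<^sup>2)"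
    if "h \<in> space ?W" "e \<in> all_edges n" for h e
    using pos[OF that] by (simp add: kern_def max_def)
  have p01: "?p (h (Min e)) (h (Max e)) \<in> {0..1}" if "e \<in> all_edges n" "h \<in> space ?W" for h e
    using pos[OF that(2,1)] f_nonneg f_le_1 by simp
  have meas_kern: "(\<lambda>h. kern (h (Min e) * h (Max e) / ?g\<^sup>2)) \<in> borel_measurable ?W"
    if "e \<in> all_edges n" for e
  proof -
    have [measurable]: "(\<lambda>h. h (Min e)) \<in> borel_measurable ?W" "(\<lambda>h. h (Max e)) \<in> borel_measurable ?W"
      using all_edges_Min_Max[OF that] by (auto intro: comp)
    show ?thesis by measurable
  qed
  \<comment> \<open>Regularity of \<open>f\<close> is known only on the nonnegative half-line, so
    measurability is taken from \<open>kern\<close>, which agrees with it on products of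
    weights.\<close>
  have meas_p: "(\<lambda>h. ?p (h (Min e)) (h (Max e))) \<in> borel_measurable ?W" if "e \<in> all_edges n" for e
  proof -
    have "?p (h (Min e)) (h (Max e)) = enn2real (kern (h (Min e) * h (Max e) / ?g\<^sup>2))" if "h \<in> space ?W" for h
      using p01[OF \<open>e \<in> all_edges n\<close> that] kern[OF that \<open>e \<in> all_edges n\<close>]
      by (metis atLeastAtMost_iff enn2real_ennreal)
    moreover have "(\<lambda>h. enn2real (kern (h (Min e) * h (Max e) / ?g\<^sup>2))) \<in> borel_measurable ?W"
      using meas_kern[OF that] by measurable
    ultimately show ?thesis by (simp cong: measurable_cong)
  qed
  have G: "?G \<in> measurable ?W (subprob_algebra (count_space UNIV))"
    using meas_p p01 by (rule measurable_graph_given_weights)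
  have sets: "sets (bind ?W ?G) = sets (count_space UNIV)"
    using W.not_empty by (intro sets_bind) auto
  have "avg_cycles \<tau> f k n = enn2real (\<integral>\<^sup>+E. ennreal (real (card (cycles k E))) \<partial>bind ?W ?G)"
    unfolding avg_cycles_def inhom_random_graph_def
    by (intro integral_eq_nn_integral) (auto simp: measurable_cong_sets[OF sets refl])
  also have "(\<integral>\<^sup>+E. ennreal (real (card (cycles k E))) \<partial>bind ?W ?G)
      = (\<integral>\<^sup>+h. \<integral>\<^sup>+E. ennreal (real (card (cycles k E))) \<partial>?G h \<partial>?W)"
    by (rule nn_integral_bind[OF _ G]) simp
  also have "\<dots> = (\<integral>\<^sup>+h. (\<Sum>c\<in>?C. \<Prod>e\<in>c. kern (h (Min e) * h (Max e) / ?g\<^sup>2)) \<partial>?W)"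
  proof (intro nn_integral_cong)
    fix h assume h: "h \<in> space ?W"
    have "(\<integral>\<^sup>+E. ennreal (real (card (cycles k E))) \<partial>?G h)
        = (\<Sum>c\<in>?C. \<Prod>e\<in>c. ennreal (?p (h (Min e)) (h (Max e))))"
      using p01[OF _ h] by (rule nn_integral_graph_cycles[OF k])
    also have "\<dots> = (\<Sum>c\<in>?C. \<Prod>e\<in>c. kern (h (Min e) * h (Max e) / ?g\<^sup>2))"
      using kern[OF h] by (intro sum.cong prod.cong) (auto simp: cycles_eq)
    finally show "(\<integral>\<^sup>+E. ennreal (real (card (cycles k E))) \<partial>?G h) = \<dots>" .
  qed
  also have "\<dots> = (\<Sum>c\<in>?C. \<integral>\<^sup>+h. (\<Prod>e\<in>c. kern (h (Min e) * h (Max e) / ?g\<^sup>2)) \<partial>?W)"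
    by (intro nn_integral_sum borel_measurable_prod_ennreal meas_kern) (auto simp: cycles_eq)
  also have "\<dots> = (\<Sum>c\<in>?C. cycle_mean k ?g)"
  proof (intro sum.cong refl)
    fix c assume "c \<in> ?C"
    then obtain v where v: "c = cyc_edges k v" "v \<in> {..<k} \<rightarrow>\<^sub>E {..<n}" "inj_on v {..<k}"
      by (auto simp: cycles_all_edges[OF k])
    let ?\<Phi> = "\<lambda>h. \<Prod>i<k. kern (h i * h (Suc i mod k) / ?g\<^sup>2)"
    have \<Phi>: "?\<Phi> \<in> borel_measurable (Pi\<^sub>M {..<k} (\<lambda>_. weight_law \<tau>))"
    proof (intro borel_measurable_prod_ennreal)
      fix i assume "i \<in> {..<k}"
      then have "Suc i mod k \<in> {..<k}" using k by simp
      note [measurable] = comp[OF this] comp[OF \<open>i \<in> {..<k}\<close>]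
      show "(\<lambda>h. kern (h i * h (Suc i mod k) / ?g\<^sup>2)) \<in> borel_measurable (Pi\<^sub>M {..<k} (\<lambda>_. weight_law \<tau>))"
        by measurable
    qed
    have "(\<Prod>e\<in>c. kern (h (Min e) * h (Max e) / ?g\<^sup>2)) = ?\<Phi> (\<lambda>i\<in>{..<k}. h (v i))" for h
    proof -
      have "(\<Prod>e\<in>c. kern (h (Min e) * h (Max e) / ?g\<^sup>2))
          = (\<Prod>i<k. kern (h (Min {v i, v (Suc i mod k)}) * h (Max {v i, v (Suc i mod k)}) / ?g\<^sup>2))"
        unfolding v(1) by (rule prod_cyc_edges[OF assms v(3)])
      \<comment> \<open>The order of the endpoints chosen by \<open>Min\<close> and
        \<open>Max\<close> is immaterial, since the kernel sees only the product of the two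
        weights.\<close>
      also have "\<dots> = ?\<Phi> (\<lambda>i\<in>{..<k}. h (v i))"
        using k by (intro prod.cong) (auto simp: min_def max_def mult.commute)
      finally show ?thesis .
    qed
    then have "(\<integral>\<^sup>+h. (\<Prod>e\<in>c. kern (h (Min e) * h (Max e) / ?g\<^sup>2)) \<partial>?W)
        = (\<integral>\<^sup>+h. ?\<Phi> (\<lambda>i\<in>{..<k}. h (v i)) \<partial>?W)"
      by simp
    also have "\<dots> = cycle_mean k ?g"
      unfolding cycle_mean_def
      using v tau by (intro nn_integral_PiM_reindex \<Phi> prob_space_weight_law) auto
    finally show "(\<integral>\<^sup>+h. (\<Prod>e\<in>c. kern (h (Min e) * h (Max e) / ?g\<^sup>2)) \<partial>?W) = cycle_mean k ?g" .
  qed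
  also have "\<dots> = of_nat (card ?C) * cycle_mean k ?g" by simp
  finally have "avg_cycles \<tau> f k n = real (card ?C) * enn2real (cycle_mean k ?g)"
    by (simp add: enn2real_mult ennreal_of_nat_eq_real_of_nat)
  moreover have "2 * real k * real (card ?C) = real (n choose k) * fact k"
    using arg_cong[OF card_cycles_all_edges[OF assms, of n], of real] by simp
  then have "real (card ?C) = 1 / (2 * real k) * real (n choose k) * fact k"
    using assms by (simp add: field_simps)
  ultimately show ?thesis by simp
qed

section \<open>Return to real integrals, growth of \<open>\<gamma>\<close>, and the limit\<close>

lemma cube_integral_eq:
  assumes "2 \<le> k"
  shows "cube_integral k A (\<lambda>t. F_fun \<tau> f k (mat_vec k (circ k) t))
         = enn2real (\<integral>\<^sup>+t. cyc_prod (\<lambda>u. ennreal (j_fun \<tau> f u)) k t * indicator (cube k A) t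
             \<partial>Pi\<^sub>M {..<k} (\<lambda>_. lborel))"
proof -
  let ?F = "\<lambda>t. F_fun \<tau> f k (mat_vec k (circ k) t)"
  have F_nonneg: "0 \<le> ?F t" for t
    by (simp add: F_fun_def prod_nonneg less_imp_le[OF j_fun_pos])
  have "cyc_prod (\<lambda>u. ennreal (j_fun \<tau> f u)) k \<in> borel_measurable (Pi\<^sub>M {..<k} (\<lambda>_. lborel))"
    by measurable
  then have "(\<lambda>t. enn2real (ennreal (?F t))) \<in> borel_measurable (Pi\<^sub>M {..<k} (\<lambda>_. lborel))"
    unfolding F_fun_circ[OF assms] by measurable
  then have [measurable]: "?F \<in> borel_measurable (Pi\<^sub>M {..<k} (\<lambda>_. lborel))"
    using F_nonneg by simp
  have "cube_integral k A ?F = enn2real (\<integral>\<^sup>+t. ennreal (indicator (cube k A) t *\<^sub>R ?F t) \<partial>Pi\<^sub>M {..<k} (\<lambda>_. lborel))"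
    unfolding cube_integral_def set_lebesgue_integral_def
    using F_nonneg by (intro integral_eq_nn_integral) auto
  also have "(\<integral>\<^sup>+t. ennreal (indicator (cube k A) t *\<^sub>R ?F t) \<partial>Pi\<^sub>M {..<k} (\<lambda>_. lborel))
      = (\<integral>\<^sup>+t. cyc_prod (\<lambda>u. ennreal (j_fun \<tau> f u)) k t * indicator (cube k A) t \<partial>Pi\<^sub>M {..<k} (\<lambda>_. lborel))"
    by (intro nn_integral_cong) (auto simp: indicator_def F_fun_circ[OF assms, symmetric])
  finally show ?thesis .
qed

lemma \<mu>_of_gt_1: "1 < \<mu>_of \<tau>"
  using tau by (simp add: \<mu>_of_def)

lemma \<gamma>_gt_1: "1 < \<gamma> \<tau> n" if "1 \<le> n"
proof -
  have "1 * 1 < real n * \<mu>_of \<tau>"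
    using that \<mu>_of_gt_1 by (intro mult_le_less_imp_less) auto
  then show ?thesis by (simp add: \<gamma>_def)
qed

lemma incseq_ln_\<gamma>: "incseq (\<lambda>n. ln (\<gamma> \<tau> n))"
proof (rule incseq_SucI)
  fix n
  show "ln (\<gamma> \<tau> n) \<le> ln (\<gamma> \<tau> (Suc n))"
  proof (cases "n = 0")
    \<comment> \<open>Here \<open>\<gamma> \<tau> 0 = 0\<close> and \<open>ln 0 = 0\<close> by
      convention, which still lies below the positive value at 1; hence monotonicity holds from the
      very first index.\<close>
    case True
    then show ?thesis using \<gamma>_gt_1[of 1] by (simp add: \<gamma>_def)
  next
    case False
    then have "0 < \<gamma> \<tau> n" using \<gamma>_gt_1[of n] by simp
    moreover have "\<gamma> \<tau> n \<le> \<gamma> \<tau> (Suc n)"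
      unfolding \<gamma>_def using \<mu>_of_gt_1 by (intro real_sqrt_le_mono mult_right_mono) auto
    ultimately show ?thesis by simp
  qed
qed

lemma ln_\<gamma>_at_top: "filterlim (\<lambda>n. ln (\<gamma> \<tau> n)) at_top sequentially"
proof -
  have "filterlim (\<lambda>n. \<mu>_of \<tau> * real n) at_top sequentially"
    using \<mu>_of_gt_1
    by (intro filterlim_tendsto_pos_mult_at_top[OF tendsto_const] filterlim_real_sequentially) simp
  then show ?thesis
    unfolding \<gamma>_def
    by (intro filterlim_compose[OF ln_at_top] filterlim_compose[OF sqrt_at_top]) (simp add: mult.commute)
qed

lemma avg_cycles_ratio:
  assumes "3 \<le> k"
  shows "(\<lambda>n. avg_cycles \<tau> f k n /
            (\<gamma> \<tau> n powr (real k * (1 - \<tau>)) * (\<tau> - 1) ^ k * (1 / (2 * real k)) *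
             real (n choose k) * fact k *
             cube_integral k (ln (\<gamma> \<tau> n)) (\<lambda>t. F_fun \<tau> f k (mat_vec k (circ k) t))))
         \<longlonglongrightarrow> 1"
proof -
  let ?\<Phi> = "cyc_prod (\<lambda>u. ennreal (j_fun \<tau> f u)) k"
  let ?P = "Pi\<^sub>M {..<k} (\<lambda>_. lborel :: real measure)"
  let ?J = "\<lambda>n. \<integral>\<^sup>+t. ?\<Phi> t * indicator (orthant k (ln (\<gamma> \<tau> n))) t \<partial>?P"
  let ?M = "\<lambda>n. \<integral>\<^sup>+t. ?\<Phi> t * indicator (cube k (ln (\<gamma> \<tau> n))) t \<partial>?P"
  let ?K = "\<lambda>n. (\<gamma> \<tau> n powr (1 - \<tau>) * (\<tau> - 1)) ^ k"
  have K: "0 < ?K n" if "1 \<le> n" for n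
    using \<gamma>_gt_1[OF that] tau by simp
  have mean: "cycle_mean k (\<gamma> \<tau> n) = ennreal (?K n) * ?J n" if "1 \<le> n" for n
    using \<gamma>_gt_1[OF that] by (intro cycle_mean_eq) simp
  have "\<forall>\<^sub>F n in sequentially. ?J n < \<top>"
    using eventually_ge_at_top[of 1]
  proof eventually_elim
    case (elim n)
    \<comment> \<open>The product is a probability; dividing by the positive \<open>?K n\<close>
      leaves \<open>?J n\<close> finite.\<close>
    have "ennreal (?K n) * ?J n < \<top>"
      using cycle_mean_le_1[of k "\<gamma> \<tau> n"] unfolding mean[OF elim]
      by (rule le_less_trans) simp
    then show ?case using K[OF elim] by (auto simp: ennreal_mult_less_top ennreal_eq_0_iff)
  qed
  from orthant_cube_ratio[OF incseq_ln_\<gamma> ln_\<gamma>_at_top this]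
  have lim: "(\<lambda>n. enn2real (?J n) / enn2real (?M n)) \<longlonglongrightarrow> 1" .
  have "\<forall>\<^sub>F n in sequentially. enn2real (?J n) / enn2real (?M n) = avg_cycles \<tau> f k n /
            (\<gamma> \<tau> n powr (real k * (1 - \<tau>)) * (\<tau> - 1) ^ k * (1 / (2 * real k)) *
             real (n choose k) * fact k *
             cube_integral k (ln (\<gamma> \<tau> n)) (\<lambda>t. F_fun \<tau> f k (mat_vec k (circ k) t)))"
    \<comment> \<open>\<open>1 \<le> n\<close> makes \<open>\<gamma> \<tau> n\<close> positive, and
      \<open>k \<le> n\<close> makes the binomial coefficient nonzero, so that the common factor
      \<open>?B * ?K n\<close> cancels.\<close>
    using eventually_ge_at_top[of "max 1 k"]
  proof eventually_elim
    case (elim n)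
    then have n: "1 \<le> n" "k \<le> n" by auto
    let ?B = "1 / (2 * real k) * real (n choose k) * fact k"
    let ?I = "cube_integral k (ln (\<gamma> \<tau> n)) (\<lambda>t. F_fun \<tau> f k (mat_vec k (circ k) t))"
    have K_eq: "\<gamma> \<tau> n powr (real k * (1 - \<tau>)) * (\<tau> - 1) ^ k = ?K n"
      using \<gamma>_gt_1[OF n(1)] by (simp add: power_mult_distrib powr_power mult.commute)
    have I: "?I = enn2real (?M n)"
      using assms by (intro cube_integral_eq) simp
    have B: "?B \<noteq> 0" using n assms by simp
    have "avg_cycles \<tau> f k n = ?B * (?K n * enn2real (?J n))"
      unfolding avg_cycles_eq[OF assms] mean[OF n(1)] using K[OF n(1)] by (simp add: enn2real_mult)
    moreover have "\<gamma> \<tau> n powr (real k * (1 - \<tau>)) * (\<tau> - 1) ^ k * (1 / (2 * real k)) *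
        real (n choose k) * fact k * ?I = ?B * (?K n * enn2real (?M n))"
      unfolding K_eq I by (simp only: mult_ac)
    ultimately show ?case
      using B less_imp_neq[OF K[OF n(1)], symmetric]
      by (simp only: mult_divide_mult_cancel_left not_False_eq_True)
  qed
  with lim show ?thesis by (rule Lim_transform_eventually)
qed

end

theorem theorem3p6:
  fixes \<tau> :: real and f :: "real \<Rightarrow> real" and k :: nat
  assumes "2 < \<tau>" and "\<tau> < 3"
    and "\<And>x. 0 \<le> x \<Longrightarrow> 0 \<le> f x"
    and "continuous_on {0..} f"
    and "mono_on {0..} f"
    and "((\<lambda>x. f x / x) \<longlongrightarrow> 1) (at_right 0)"
    and "(f \<longlongrightarrow> 1) at_top"
    and "3 \<le> k"
  shows "(\<lambda>n. avg_cycles \<tau> f k n /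
            (\<gamma> \<tau> n powr (real k * (1 - \<tau>)) * (\<tau> - 1) ^ k * (1 / (2 * real k)) *
             real (n choose k) * fact k *
             cube_integral k (ln (\<gamma> \<tau> n)) (\<lambda>t. F_fun \<tau> f k (mat_vec k (circ k) t))))
         \<longlonglongrightarrow> 1"
proof -
  interpret connection_kernel \<tau> f
    using assms(1-7) by unfold_locales
  show ?thesis using assms(8) by (rule avg_cycles_ratio)
qed

end
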